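(* Let $\lambda>0$ and $\omega\in\mathbb R$ with $\omega\neq 0$, let $n\ge 2$, and consider the complex model $Z(t)=m+Y(t)$, where $Y$ is the normalized stationary complex Ornstein-Uhlenbeck process with damping $\lambda$ and frequency $\omega$, observed in design points $0\le t_1<t_2<\dots<t_n$, with $d_j:=t_{j+1}-t_j$, $j=1,\dots,n-1$. Let $$g(x):=\frac{1-2e^{-\lambda x}\cos(\omega x)+e^{-2\lambda x}}{1-e^{-2\lambda x}},\quad x>0,\qquad g(0):=0.$$ Then $g$ has a global maximum, and the D-optimal design for estimating the trend parameter $m=m_1+im_2$ (that is, the design maximizing $\det(\mathcal I_{m_1,m_2}(n))$) is equidistant with $$d_1=d_2=\dots=d_{n-1}=d^*,$$ where $d^*$ is the global maximum point of $g$.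
   Context: $Y=Y_1+iY_2$ is the stationary solution of $dY(t)=-(\lambda-i\omega)Y(t)\,dt+\sigma\,d\mathcal W(t)$, where $\mathcal W=\mathcal W_1+i\mathcal W_2$ with $\mathcal W_1,\mathcal W_2$ independent standard Brownian motions, normalized so that $\sigma^2/(2\lambda)=1$. Thus $(Y_1(t),Y_2(t))^\top$ is a centered Gaussian process with, for $\tau\ge0$, $$\mathsf E\begin{bmatrix}Y_1(t+\tau)\\ Y_2(t+\tau)\end{bmatrix}\begin{bmatrix}Y_1(t)\\ Y_2(t)\end{bmatrix}^\top=e^{-\lambda\tau}\begin{bmatrix}\cos(\omega\tau)&-\sin(\omega\tau)\\ \sin(\omega\tau)&\cos(\omega\tau)\end{bmatrix}.$$ The parameters $\lambda,\omega$ are treated as known and $m=m_1+im_2$, $m_1,m_2\in\mathbb R$, is unknown. With $Z=Z_1+iZ_2$ one has $Z_1=m_1+Y_1$, $Z_2=m_2+Y_2$. The Fisher information matrix on $(m_1,m_2)^\top$ based on $\{(Z_1(t_j),Z_2(t_j)),\ j=1,\dots,n\}$ is $$\mathcal I_{m_1,m_2}(n)=H(n)C(n)^{-1}H(n)^\top,\qquad H(n)=[\mathbb I_2\ \mathbb I_2\ \cdots\ \mathbb I_2]\in\mathbb R^{2\times 2n},$$ where $\mathbb I_2$ is the $2\times2$ unit matrix and $C(n)$ is the $2n\times2n$ covariance matrix of $(Z_1(t_1),Z_2(t_1),\dots,Z_1(t_n),Z_2(t_n))^\top$. It depends on the design only through $(d_1,\dots,d_{n-1})$. A D-optimal design maximizes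 $\det(\mathcal I_{m_1,m_2}(n))$ over all designs $0\le t_1<\dots<t_n$ with $n$ points (equivalently over $d_1,\dots,d_{n-1}>0$). *)

theory Defs
  imports "HOL-Probability.Probability" "Jordan_Normal_Form.Gauss_Jordan_Elimination"
    "Jordan_Normal_Form.Determinant"
begin

definition standard_brownian_motion ::
  "'a measure \<Rightarrow> (real \<Rightarrow> 'a measure) \<Rightarrow> (real \<Rightarrow> 'a \<Rightarrow> real) \<Rightarrow> bool" where
  "standard_brownian_motion M F W \<longleftrightarrow>
     (\<forall>t\<ge>0. W t \<in> borel_measurable (F t)) \<and>
     (AE \<xi> in M. W 0 \<xi> = 0) \<and>
     (\<forall>\<xi>\<in>space M. continuous_on {0..} (\<lambda>t. W t \<xi>)) \<and>
     (\<forall>s t. 0 \<le> s \<and> s < t \<longrightarrow>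
        distributed M lborel (\<lambda>\<xi>. W t \<xi> - W s \<xi>) (normal_density 0 (sqrt (t - s))) \<and>
        prob_space.indep_set M (sets (F s))
          (sets (vimage_algebra (space M) (\<lambda>\<xi>. W t \<xi> - W s \<xi>) borel)))"

definition independent_processes ::
  "'a measure \<Rightarrow> (real \<Rightarrow> 'a \<Rightarrow> real) \<Rightarrow> (real \<Rightarrow> 'a \<Rightarrow> real) \<Rightarrow> bool" where
  "independent_processes M W1 W2 \<longleftrightarrow>
     prob_space.indep_var M
       (PiM {0..} (\<lambda>_. borel)) (\<lambda>\<xi>. \<lambda>t\<in>{0..}. W1 t \<xi>)
       (PiM {0..} (\<lambda>_. borel)) (\<lambda>\<xi>. \<lambda>t\<in>{0..}. W2 t \<xi>)"

definition stationary_process :: "'a measure \<Rightarrow> (real \<Rightarrow> 'a \<Rightarrow> complex) \<Rightarrow> bool" where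
  "stationary_process M Y \<longleftrightarrow>
     (\<forall>h\<ge>0. distr M (PiM {0..} (\<lambda>_. borel)) (\<lambda>\<xi>. \<lambda>t\<in>{0..}. Y (t + h) \<xi>) =
             distr M (PiM {0..} (\<lambda>_. borel)) (\<lambda>\<xi>. \<lambda>t\<in>{0..}. Y t \<xi>))"

text \<open>
  Stationary solution of \<open>dY = -(\<lambda> - i \<omega>) Y dt + \<sigma> d(W1 + i W2)\<close> on the time axis \<open>[0, \<infinity>)\<close>.
  Since the noise is additive, the equation is written in its pathwise integrated form.
  As usual, \<open>Y\<close> and the Brownian motions are adapted to a common filtration \<open>F\<close>, with respect
  to which the future increments of the Brownian motions are independent of the past.
  Neither Gaussianity nor the covariance function is assumed.
\<close>

definition stationary_complex_OU ::
  "'a measure \<Rightarrow> (real \<Rightarrow> 'a measure) \<Rightarrow> (real \<Rightarrow> 'a \<Rightarrow> real) \<Rightarrow> (real \<Rightarrow> 'a \<Rightarrow> real)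
    \<Rightarrow> real \<Rightarrow> real \<Rightarrow> real \<Rightarrow> (real \<Rightarrow> 'a \<Rightarrow> complex) \<Rightarrow> bool" where
  "stationary_complex_OU M F W1 W2 lam \<omega> \<sigma> Y \<longleftrightarrow>
     prob_space M \<and> filtration (space M) F \<and> (\<forall>t\<ge>0. subalgebra M (F t)) \<and>
     standard_brownian_motion M F W1 \<and> standard_brownian_motion M F W2 \<and>
     independent_processes M W1 W2 \<and>
     (\<forall>t\<ge>0. Y t \<in> borel_measurable (F t)) \<and>
     (\<forall>\<xi>\<in>space M. continuous_on {0..} (\<lambda>t. Y t \<xi>)) \<and>
     (AE \<xi> in M. \<forall>t\<ge>0.
        Y t \<xi> = Y 0 \<xi> - (of_real lam - \<i> * of_real \<omega>) * integral {0..t} (\<lambda>s. Y s \<xi>)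
                + of_real \<sigma> * (of_real (W1 t \<xi>) + \<i> * of_real (W2 t \<xi>))) \<and>
     stationary_process M Y"

text \<open>The design points are \<open>t 1, \<dots>, t n\<close>; other values of the function \<open>t\<close> are irrelevant.\<close>

definition design :: "nat \<Rightarrow> (nat \<Rightarrow> real) \<Rightarrow> bool" where
  "design n t \<longleftrightarrow> 0 \<le> t 1 \<and> strict_mono_on {1..n} t"

text \<open>
  Matrix indices start at 0, so position \<open>k\<close> of the observation vector
  \<open>(Z\<^sub>1(t\<^sub>1), Z\<^sub>2(t\<^sub>1), \<dots>, Z\<^sub>1(t\<^sub>n), Z\<^sub>2(t\<^sub>n))\<close> belongs to the design point \<open>t (k div 2 + 1)\<close>.
\<close>

definition observation :: "(real \<Rightarrow> 'a \<Rightarrow> complex) \<Rightarrow> (nat \<Rightarrow> real) \<Rightarrow> nat \<Rightarrow> 'a \<Rightarrow> real" where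
  "observation Z t k \<xi> =
     (if even k then Re (Z (t (k div 2 + 1)) \<xi>) else Im (Z (t (k div 2 + 1)) \<xi>))"

definition covariance :: "'a measure \<Rightarrow> ('a \<Rightarrow> real) \<Rightarrow> ('a \<Rightarrow> real) \<Rightarrow> real" where
  "covariance M U V =
     (LINT \<xi>|M. (U \<xi> - (LINT \<eta>|M. U \<eta>)) * (V \<xi> - (LINT \<eta>|M. V \<eta>)))"

definition C_mat ::
  "'a measure \<Rightarrow> (real \<Rightarrow> 'a \<Rightarrow> complex) \<Rightarrow> nat \<Rightarrow> (nat \<Rightarrow> real) \<Rightarrow> real mat" where
  "C_mat M Z n t =
     mat (2 * n) (2 * n) (\<lambda>(k, l). covariance M (observation Z t k) (observation Z t l))"

definition H_mat :: "nat \<Rightarrow> real mat" where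
  "H_mat n = mat 2 (2 * n) (\<lambda>(i, k). if k mod 2 = i then 1 else 0)"

definition fisher_information ::
  "'a measure \<Rightarrow> (real \<Rightarrow> 'a \<Rightarrow> complex) \<Rightarrow> nat \<Rightarrow> (nat \<Rightarrow> real) \<Rightarrow> real mat" where
  "fisher_information M Z n t =
     H_mat n * the (mat_inverse (C_mat M Z n t)) * transpose_mat (H_mat n)"

definition D_optimal ::
  "'a measure \<Rightarrow> (real \<Rightarrow> 'a \<Rightarrow> complex) \<Rightarrow> nat \<Rightarrow> (nat \<Rightarrow> real) \<Rightarrow> bool" where
  "D_optimal M Z n t \<longleftrightarrow>
     is_arg_max (\<lambda>t. Determinant.det (fisher_information M Z n t)) (design n) t"

definition g :: "real \<Rightarrow> real \<Rightarrow> real \<Rightarrow> real" where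
  "g lam \<omega> x =
     (if x = 0 then 0
      else (1 - 2 * exp (- lam * x) * cos (\<omega> * x) + exp (- 2 * lam * x)) / (1 - exp (- 2 * lam * x)))"

end

theory Submission
  imports Defs
begin

text \<open>
  Solving the equation pathwise gives \<open>Y(t) = e\<^sup>-\<^sup>a\<^sup>(\<^sup>t\<^sup>-\<^sup>s\<^sup>) Y(s) + N(s,t)\<close> with \<open>a = \<lambda> - i\<omega>\<close> and an innovation \<open>N\<close>
  that is orthogonal to the past. Stationarity together with the contraction \<open>\<bar>e\<^sup>-\<^sup>a\<bar> < 1\<close> makes \<open>Y(0)\<close>
  square integrable, and comparing \<open>E N\<^sup>2\<close> and \<open>E \<bar>N\<bar>\<^sup>2\<close> with the increments of the Brownian motions over
  short times determines its second moments: \<open>E Y\<^sup>2 = 0\<close> and \<open>E \<bar>Y\<bar>\<^sup>2 = 2\<close>.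
  The complex covariance matrix therefore has the Markov factorisation \<open>K(i,k) = K(i,j) K(j,k)\<close>, and
  passing to the uncorrelated innovations diagonalises it. Hence the Fisher information is
  \<open>1 + g(d\<^sub>1) + \<dots> + g(d\<^sub>n\<^sub>-\<^sub>1)\<close> times the identity, and it remains to maximise \<open>g\<close>.
  Up to a positive factor \<open>g'\<close> is \<open>\<lambda> cosh(\<lambda>x) cos(\<omega>x) + \<omega> sinh(\<lambda>x) sin(\<omega>x) - \<lambda>\<close>, whose derivative is a
  positive multiple of \<open>cos(\<omega>x)\<close>; so for \<open>\<omega> > 0\<close> it has exactly one zero in \<open>(0, \<pi>/\<omega>]\<close>, while beyond \<open>\<pi>/\<omega>\<close>
  one has \<open>g(x) \<le> coth(\<lambda>x/2) < g(\<pi>/\<omega>)\<close>.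
\<close>

section \<open>The maximum of g\<close>

text \<open>Multiplying numerator and denominator by \<open>exp (lam * x) / 2\<close> removes the
  negative exponentials; the derivative of the quotient then simplifies through
  \<open>hyperbolic_pythagoras\<close>.\<close>

lemma g_eq_hyperbolic:
  assumes "lam > 0" "x > 0"
  shows "g lam \<omega> x = (cosh (lam * x) - cos (\<omega> * x)) / sinh (lam * x)"
proof -
  define u where "u = exp (lam * x)"
  have u: "u > 1" using assms by (simp add: u_def)
  have e: "exp (- lam * x) = 1 / u" "exp (- 2 * lam * x) = 1 / u\<^sup>2"
    by (simp_all add: u_def exp_minus inverse_eq_divide power2_eq_square flip: exp_add)
  have "g lam \<omega> x = (1 - 2 * (1 / u) * cos (\<omega> * x) + 1 / u\<^sup>2) / (1 - 1 / u\<^sup>2)"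
    using assms(2) unfolding g_def e by simp
  also have "\<dots> = (u\<^sup>2 - 2 * u * cos (\<omega> * x) + 1) / (u\<^sup>2 - 1)"
  proof -
    have "1 - 2 * (1 / u) * cos (\<omega> * x) + 1 / u\<^sup>2 = (u\<^sup>2 - 2 * u * cos (\<omega> * x) + 1) / u\<^sup>2"
      "1 - 1 / u\<^sup>2 = (u\<^sup>2 - 1) / u\<^sup>2"
      using u by (simp_all add: field_simps power2_eq_square)
    then show ?thesis using u by simp
  qed
  also have "\<dots> = ((u + 1 / u) / 2 - cos (\<omega> * x)) / ((u - 1 / u) / 2)"
  proof -
    have k: "A / B = (A / (2 * u)) / (B / (2 * u))" for A B
      using u by simp
    have e1: "(u + 1 / u) / 2 - cos (\<omega> * x) = (u\<^sup>2 - 2 * u * cos (\<omega> * x) + 1) / (2 * u)"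
      and e2: "(u - 1 / u) / 2 = (u\<^sup>2 - 1) / (2 * u)"
      using u by (simp_all add: field_simps power2_eq_square)
    show ?thesis unfolding e1 e2 by (rule k)
  qed
  also have "\<dots> = (cosh (lam * x) - cos (\<omega> * x)) / sinh (lam * x)"
    by (simp add: u_def cosh_field_def sinh_field_def exp_minus inverse_eq_divide)
  finally show ?thesis .
qed

text \<open>The quotient is coth(x/2), the upper envelope of \<open>g\<close> (up to scaling by
  \<open>lam\<close>) obtained by replacing the cosine by -1. Its derivative has numerator -1 -
  cosh.\<close>

lemma coth_half_strict_antimono:
  fixes x y :: real
  assumes "0 < x" "x < y"
  shows "(cosh y + 1) / sinh y < (cosh x + 1) / sinh x"
proof (rule DERIV_neg_imp_decreasing[OF assms(2)])
  fix z :: real assume z: "x \<le> z" "z \<le> y"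
  then have s: "sinh z > 0" using assms by simp
  have "((\<lambda>z. (cosh z + 1) / sinh z) has_real_derivative
      (sinh z * sinh z - (cosh z + 1) * cosh z) / (sinh z * sinh z)) (at z)"
    using s by (auto intro!: derivative_eq_intros)
  moreover have "(sinh z * sinh z - (cosh z + 1) * cosh z) / (sinh z * sinh z) < 0"
  proof -
    have "sinh z * sinh z - (cosh z + 1) * cosh z = - 1 - cosh z"
      using hyperbolic_pythagoras[of z] by (simp add: algebra_simps power2_eq_square)
    then show ?thesis using s cosh_real_ge_1[of z] by (simp add: divide_less_0_iff)
  qed
  ultimately show "\<exists>D. ((\<lambda>z. (cosh z + 1) / sinh z) has_real_derivative D) (at z) \<and> D < 0"
    by blast
qed

lemma g_unique_maximum_pos:
  assumes lam: "lam > 0" and w: "\<omega> > 0"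
  shows "\<exists>d>0. \<forall>x\<ge>0. x \<noteq> d \<longrightarrow> g lam \<omega> x < g lam \<omega> d"
proof -
  \<comment> \<open>\<open>h\<close> is the numerator of the derivative of \<open>?G\<close>, as
    \<open>G'\<close> shows. At \<open>p\<close> the cosine vanishes and \<open>h\<close> turns from
    increasing to decreasing; at \<open>P\<close> the cosine is -1 and \<open>?G\<close> touches its
    envelope.\<close>
  define h where "h x = lam * cosh (lam * x) * cos (\<omega> * x) + \<omega> * sinh (lam * x) * sin (\<omega> * x) - lam" for x
  define p P where "p = pi / (2 * \<omega>)" and "P = pi / \<omega>"
  let ?G = "\<lambda>x. (cosh (lam * x) - cos (\<omega> * x)) / sinh (lam * x)"
  have pP: "0 < p" "p < P" "\<omega> * p = pi / 2" "\<omega> * P = pi"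
    using w by (auto simp: p_def P_def field_simps)
  have h': "(h has_real_derivative (lam\<^sup>2 + \<omega>\<^sup>2) * sinh (lam * x) * cos (\<omega> * x)) (at x)" for x
    unfolding h_def
    by (auto intro!: derivative_eq_intros simp: algebra_simps power2_eq_square)
  have cont_h: "continuous_on {a..b} h" for a b
    by (rule DERIV_continuous_on[OF DERIV_subset[OF h']]) auto
  have h_inc: "h x > 0" if x: "0 < x" "x \<le> p" for x
  proof -
    have "h 0 < h x"
    proof (rule DERIV_pos_imp_increasing_open[OF x(1) _ cont_h], intro exI conjI, rule h')
      fix y assume y: "0 < y" "y < x"
      then have "\<omega> * y < \<omega> * p" using x w by simp
      then have "cos (\<omega> * y) > 0" using y w pP(3) by (intro cos_gt_zero_pi) (auto intro: less_trans[of _ 0])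
      then show "(lam\<^sup>2 + \<omega>\<^sup>2) * sinh (lam * y) * cos (\<omega> * y) > 0"
        using lam w y by (simp add: add_pos_pos)
    qed
    then show ?thesis by (simp add: h_def)
  qed
  have h_dec: "h y < h x" if xy: "p \<le> x" "x < y" "y \<le> P" for x y
  proof (rule DERIV_neg_imp_decreasing_open[OF xy(2) _ cont_h], intro exI conjI, rule h')
    fix z assume z: "x < z" "z < y"
    then have "\<omega> * p < \<omega> * z" "\<omega> * z < \<omega> * P" using xy w by simp_all
    then have "cos (\<omega> * z) < cos (pi / 2)" using pP by (intro cos_monotone_0_pi) auto
    then have "cos (\<omega> * z) < 0" by simp
    moreover have "(lam\<^sup>2 + \<omega>\<^sup>2) * sinh (lam * z) > 0"
      using lam w z xy pP(1) by (simp add: add_pos_pos)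
    ultimately show "(lam\<^sup>2 + \<omega>\<^sup>2) * sinh (lam * z) * cos (\<omega> * z) < 0"
      by (rule mult_pos_neg[rotated])
  qed
  \<comment> \<open>\<open>h\<close> is nonnegative at \<open>p\<close>, nonpositive at
    \<open>P\<close> and strictly decreasing in between, so its zero \<open>d\<close> is where
    \<open>?G\<close> turns from increasing to decreasing.\<close>
  have "h P = - (lam * cosh (lam * P)) - lam" using pP by (simp add: h_def)
  moreover have "lam * cosh (lam * P) \<ge> 0" using lam cosh_real_ge_1[of "lam * P"] by simp
  ultimately have "h P \<le> 0" using lam by linarith
  moreover have "0 \<le> h p" "p \<le> P" using h_inc[of p] pP by simp_all
  ultimately obtain d where d: "p \<le> d" "d \<le> P" "h d = 0"
    using IVT2'[of h P 0 p] cont_h[of p P] by blast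
  have dpos: "d > 0" using d pP by simp
  have G': "(?G has_real_derivative h x / (sinh (lam * x))\<^sup>2) (at x)" if "x > 0" for x
  proof -
    have s: "sinh (lam * x) \<noteq> 0" using that lam by simp
    have "(?G has_real_derivative ((lam * sinh (lam * x) + \<omega> * sin (\<omega> * x)) * sinh (lam * x)
        - (cosh (lam * x) - cos (\<omega> * x)) * (lam * cosh (lam * x))) / (sinh (lam * x) * sinh (lam * x))) (at x)"
      using s by (auto intro!: derivative_eq_intros simp: algebra_simps)
    also have "(lam * sinh (lam * x) + \<omega> * sin (\<omega> * x)) * sinh (lam * x)
        - (cosh (lam * x) - cos (\<omega> * x)) * (lam * cosh (lam * x)) = h x
        - lam * ((cosh (lam * x))\<^sup>2 - (sinh (lam * x))\<^sup>2 - 1)"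
      by (simp add: h_def algebra_simps power2_eq_square)
    finally show ?thesis using hyperbolic_pythagoras[of "lam * x"] by (simp add: power2_eq_square)
  qed
  have contG: "continuous_on {a..b} ?G" if "a > 0" for a b
    by (rule DERIV_continuous_on[OF DERIV_subset[OF G']]) (use that in auto)
  have less_d: "?G x < ?G d" if x: "0 < x" "x < d" for x
  proof (rule DERIV_pos_imp_increasing_open[OF x(2) _ contG[OF x(1)]], intro exI conjI, rule G')
    fix y assume y: "x < y" "y < d"
    have "h y > 0"
    proof (cases "y \<le> p")
      case False
      then show ?thesis using h_dec[of y d] y d by simp
    qed (use h_inc x y in auto)
    moreover show "y > 0" using x y by simp
    ultimately show "h y / (sinh (lam * y))\<^sup>2 > 0" using lam by simp
  qed
  have greater_d: "?G x < ?G d" if x: "d < x" "x \<le> P" for x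
  proof (rule DERIV_neg_imp_decreasing_open[OF x(1) _ contG[OF dpos]], intro exI conjI, rule G')
    fix y assume y: "d < y" "y < x"
    have "h y < 0" using h_dec[of d y] y d x by simp
    moreover show "y > 0" using y dpos by simp
    ultimately show "h y / (sinh (lam * y))\<^sup>2 < 0" using lam by (simp add: divide_less_0_iff)
  qed
  \<comment> \<open>Beyond \<open>P\<close> the quotient may oscillate, but its decreasing envelope
    already lies below the value at \<open>P\<close>, which equals \<open>?G P\<close>.\<close>
  have beyond: "?G x < ?G d" if x: "P < x" for x
  proof -
    have "?G x \<le> (cosh (lam * x) + 1) / sinh (lam * x)"
      using cos_ge_minus_one[of "\<omega> * x"] lam x pP by (intro divide_right_mono) auto
    also have "\<dots> < (cosh (lam * P) + 1) / sinh (lam * P)"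
      using lam x pP by (intro coth_half_strict_antimono) auto
    also have "\<dots> = ?G P" using pP by simp
    also have "\<dots> \<le> ?G d" using greater_d[of P] d by (cases "d = P") auto
    finally show ?thesis .
  qed
  have "g lam \<omega> x < g lam \<omega> d" if x: "x \<ge> 0" "x \<noteq> d" for x
  proof (cases "x = 0")
    case True
    have "cosh (lam * d) > 1" using cosh_real_strict_mono[of 0 "lam * d"] lam dpos by simp
    then have "cosh (lam * d) - cos (\<omega> * d) > 0"
      using cos_le_one[of "\<omega> * d"] by linarith
    then have "?G d > 0" using lam dpos by (intro divide_pos_pos) auto
    then show ?thesis using True g_eq_hyperbolic[OF lam dpos] by (simp add: g_def)
  next
    case False
    then have "?G x < ?G d" using less_d[of x] greater_d[of x] beyond[of x] x by linarith
    then show ?thesis using False x g_eq_hyperbolic[OF lam] dpos by simp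
  qed
  then show ?thesis using dpos by blast
qed

text \<open>\<open>g\<close> contains \<open>\<omega>\<close> only inside the even function
  \<open>cos\<close>, so a negative frequency may be replaced by its absolute value.\<close>

lemma g_unique_maximum:
  assumes "lam > 0" "\<omega> \<noteq> 0"
  shows "\<exists>d>0. \<forall>x\<ge>0. x \<noteq> d \<longrightarrow> g lam \<omega> x < g lam \<omega> d"
proof -
  have "g lam \<bar>\<omega>\<bar> = g lam \<omega>"
    by (auto simp: g_def fun_eq_iff abs_if)
  then show ?thesis using g_unique_maximum_pos[of lam "\<bar>\<omega>\<bar>"] assms by simp
qed

text \<open>Holds because cosh \<ge> 1 \<ge> cos. It keeps 1 plus a sum of values of
  \<open>g\<close> nonnegative, so that comparing determinants, which are squares, amounts to
  comparing the sums.\<close>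

lemma g_nonneg:
  assumes "lam > 0" "x \<ge> 0"
  shows "g lam \<omega> x \<ge> 0"
proof (cases "x = 0")
  case False
  have "cosh (lam * x) - cos (\<omega> * x) \<ge> 0"
    using cosh_real_ge_1[of "lam * x"] cos_le_one[of "\<omega> * x"] by linarith
  then have "(cosh (lam * x) - cos (\<omega> * x)) / sinh (lam * x) \<ge> 0"
    using assms by (intro divide_nonneg_nonneg) auto
  then show ?thesis
    using assms False g_eq_hyperbolic[of lam x] by simp
qed (simp add: g_def)

section \<open>Fisher information of a Markov covariance kernel\<close>

text \<open>Identifies the optional result of \<open>mat_inverse\<close> with a known inverse:
  \<open>None\<close> would contradict that \<open>A\<close> is a unit of the matrix ring, and a
  two-sided inverse is unique.\<close>

lemma the_mat_inverse:
  assumes "A \<in> carrier_mat n n" "B \<in> carrier_mat n n" "A * B = 1\<^sub>m n" "B * A = 1\<^sub>m n"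
  shows "the (mat_inverse A) = B"
proof (cases "mat_inverse A")
  case None
  have "A \<in> Units (ring_mat TYPE('a) n ())"
    unfolding Units_def ring_mat_def using assms by auto
  then show ?thesis using mat_inverse(1)[OF assms(1) None, of "()"] by blast
next
  case (Some X)
  then have X: "X * A = 1\<^sub>m n" "X \<in> carrier_mat n n"
    using mat_inverse(2)[OF assms(1)] by auto
  have "X = X * (A * B)" using X assms(3) by simp
  also have "\<dots> = (X * A) * B" using assoc_mult_mat[OF X(2) assms(1,2)] by simp
  also have "\<dots> = B" using X(1) assms(2) by simp
  finally show ?thesis using Some by simp
qed

text \<open>Turns the covariance \<open>E[Y\<^sub>j cnj Y\<^sub>k] / 2\<close> of a circular complex vector into the covariance of its
  interleaved real and imaginary parts.\<close>

definition realify :: "complex mat \<Rightarrow> real mat" where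
  "realify A = mat (2 * dim_row A) (2 * dim_col A) (\<lambda>(k, l).
     let z = A $$ (k div 2, l div 2) in
     if even k then (if even l then Re z else - Im z) else (if even l then Im z else Re z))"

lemma realify_carrier: "A \<in> carrier_mat n m \<Longrightarrow> realify A \<in> carrier_mat (2 * n) (2 * m)"
  by (auto simp: realify_def)

lemma sum_even_odd: "(\<Sum>l\<in>{0..<2 * n}. f l) = (\<Sum>j\<in>{0..<n}. f (2 * j) + f (2 * j + 1 :: nat))"
  for f :: "nat \<Rightarrow> 'a :: comm_monoid_add"
  by (induction n) (simp_all add: add.assoc)

text \<open>Each entry z becomes the block with rows (Re z, -Im z) and (Im z, Re z), the real matrix
  of multiplication by z, so block products mirror complex products. The inner sum over
  \<open>2 * m\<close> indices is regrouped into pairs.\<close>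

lemma realify_mult:
  assumes "A \<in> carrier_mat n m" "B \<in> carrier_mat m p"
  shows "realify (A * B) = realify A * realify B"
proof (rule eq_matI)
  fix k l assume kl: "k < dim_row (realify A * realify B)" "l < dim_col (realify A * realify B)"
  then have k: "k < 2 * n" "k div 2 < n" and l: "l < 2 * p" "l div 2 < p"
    using assms by (auto simp: realify_def)
  have entries: "realify A $$ (k, 2 * j) = (if even k then Re (A $$ (k div 2, j)) else Im (A $$ (k div 2, j)))"
    "realify A $$ (k, 2 * j + 1) = (if even k then - Im (A $$ (k div 2, j)) else Re (A $$ (k div 2, j)))"
    "realify B $$ (2 * j, l) = (if even l then Re (B $$ (j, l div 2)) else - Im (B $$ (j, l div 2)))"
    "realify B $$ (2 * j + 1, l) = (if even l then Im (B $$ (j, l div 2)) else Re (B $$ (j, l div 2)))"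
    if "j < m" for j
    using assms k l that by (simp_all add: realify_def Let_def)
  have AB: "(A * B) $$ (k div 2, l div 2) = (\<Sum>j\<in>{0..<m}. A $$ (k div 2, j) * B $$ (j, l div 2))"
    using assms k l by (simp add: scalar_prod_def)
  have "(realify A * realify B) $$ (k, l)
      = (\<Sum>i\<in>{0..<2 * m}. realify A $$ (k, i) * realify B $$ (i, l))"
    using assms k l by (simp add: scalar_prod_def realify_def)
  also have "\<dots> = (\<Sum>j\<in>{0..<m}. realify A $$ (k, 2 * j) * realify B $$ (2 * j, l)
      + realify A $$ (k, 2 * j + 1) * realify B $$ (2 * j + 1, l))"
    by (rule sum_even_odd)
  also have "\<dots> = (\<Sum>j\<in>{0..<m}. let z = A $$ (k div 2, j) * B $$ (j, l div 2) in
      if even k then (if even l then Re z else - Im z) else (if even l then Im z else Re z))"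
    by (rule sum.cong) (simp_all only: entries atLeastLessThan_iff, simp add: Let_def)
  also have "\<dots> = (let z = (A * B) $$ (k div 2, l div 2) in
      if even k then (if even l then Re z else - Im z) else (if even l then Im z else Re z))"
    unfolding AB by (simp add: Let_def flip: sum_negf)
  also have "\<dots> = realify (A * B) $$ (k, l)"
    using assms k l by (simp add: realify_def del: index_mult_mat(1))
  finally show "realify (A * B) $$ (k, l) = (realify A * realify B) $$ (k, l)" ..
qed (use assms in \<open>auto simp: realify_def\<close>)

lemma realify_one: "realify (1\<^sub>m n) = 1\<^sub>m (2 * n)"
proof (rule eq_matI)
  fix k l assume "k < dim_row (1\<^sub>m (2 * n) :: real mat)" "l < dim_col (1\<^sub>m (2 * n) :: real mat)"
  then have "k < 2 * n" "l < 2 * n" "k div 2 < n" "l div 2 < n" by auto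
  moreover have "k = l \<longleftrightarrow> k div 2 = l div 2 \<and> even k = even l" by presburger
  ultimately show "realify (1\<^sub>m n) $$ (k, l) = 1\<^sub>m (2 * n) $$ (k, l)"
    by (auto simp: realify_def Let_def)
qed (auto simp: realify_def)

text \<open>\<open>H_mat n\<close> is a row of unit blocks, each representing the number 1. This
  reduces the Fisher information to a complex scalar, the quadratic form of the inverse kernel at
  the all-ones vector.\<close>

lemma realify_ones_row: "realify (mat 1 n (\<lambda>_. 1)) = H_mat n"
  by (rule eq_matI) (auto simp: realify_def H_mat_def less_2_cases_iff odd_iff_mod_2_eq_one)

lemma realify_ones_col: "realify (mat n 1 (\<lambda>_. 1)) = transpose_mat (H_mat n)"
  by (rule eq_matI) (auto simp: realify_def H_mat_def less_2_cases_iff odd_iff_mod_2_eq_one)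

text \<open>A real scalar turns into \<open>c\<close> times the unit matrix of size 2; hence the
  determinant of the information is a square.\<close>

lemma det_realify_of_real: "Determinant.det (realify (mat 1 1 (\<lambda>_. of_real c))) = c\<^sup>2"
proof -
  have "realify (mat 1 1 (\<lambda>_. of_real c)) = c \<cdot>\<^sub>m 1\<^sub>m 2"
    by (rule eq_matI) (auto simp: realify_def less_2_cases_iff)
  then show ?thesis by (simp add: power2_eq_square)
qed

lemma sum_bidiagonal:
  fixes f c :: "nat \<Rightarrow> 'a :: comm_ring_1"
  assumes "j < n"
  shows "(\<Sum>i\<in>{0..<n}. (if i = j then 1 else if j = Suc i then - c i else 0) * f i)
    = f j - (if j = 0 then 0 else c (j - 1) * f (j - 1))"
proof -
  \<comment> \<open>Two deltas, at \<open>j\<close> and at \<open>j - 1\<close>. For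
    \<open>j = 0\<close> the truncated difference is 0 again, so the second delta carries an
    explicit zero.\<close>
  have "(\<Sum>i\<in>{0..<n}. (if i = j then 1 else if j = Suc i then - c i else 0) * f i)
    = (\<Sum>i\<in>{0..<n}. if i = j then f i else 0)
      + (\<Sum>i\<in>{0..<n}. if i = j - 1 then (if j = 0 then 0 else - c i * f i) else 0)"
    unfolding sum.distrib[symmetric] by (rule sum.cong) auto
  also have "\<dots> = f j - (if j = 0 then 0 else c (j - 1) * f (j - 1))"
    using assms by (subst (1 2) sum.delta) auto
  finally show ?thesis .
qed

section \<open>Innovations and the explicit inverse of a Markov covariance matrix\<close>

locale markov_kernel =
  fixes \<kappa> :: "nat \<Rightarrow> nat \<Rightarrow> complex" and n :: nat
  assumes diag: "j < n \<Longrightarrow> \<kappa> j j = 1"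
    and markov: "k \<le> j \<Longrightarrow> j \<le> i \<Longrightarrow> i < n \<Longrightarrow> \<kappa> i k = \<kappa> i j * \<kappa> j k"
    and hermitian: "i < n \<Longrightarrow> j < n \<Longrightarrow> \<kappa> j i = cnj (\<kappa> i j)"
    and contraction: "Suc j < n \<Longrightarrow> cmod (\<kappa> (Suc j) j) < 1"
begin

text \<open>With \<open>\<kappa> i j\<close> read as E(Y_i cnj Y_j) / 2, these are the equally
  scaled variance of the innovation Y_j - \<open>\<kappa> j (j - 1)\<close> Y_(j-1) and its mean
  when all observations have mean 1. The first observation is its own innovation.\<close>

abbreviation (input) "innov_var j \<equiv> (if j = 0 then 1 else 1 - (cmod (\<kappa> j (j - 1)))\<^sup>2)"
abbreviation (input) "innov_mean j \<equiv> (if j = 0 then 1 else 1 - \<kappa> j (j - 1))"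

definition "K = mat n n (\<lambda>(j, k). \<kappa> j k)"
definition "L = mat n n (\<lambda>(j, k). if k = j then 1 else if j = Suc k then - \<kappa> j k else 0)"
text \<open>The conjugate transpose of \<open>L\<close>.\<close>

definition "L_adj = mat n n (\<lambda>(j, k). if j = k then 1 else if k = Suc j then - cnj (\<kappa> k j) else 0)"
definition "D_inv = mat n n (\<lambda>(j, k). if j = k then complex_of_real (1 / innov_var j) else 0)"
text \<open>The shape forced by \<open>L * K * L_adj\<close> being diagonal with the innovation
  variances as entries.\<close>

definition "K_inv = L_adj * D_inv * L"

lemma carriers [simp]:
  "K \<in> carrier_mat n n" "L \<in> carrier_mat n n" "L_adj \<in> carrier_mat n n"
  "D_inv \<in> carrier_mat n n" "K_inv \<in> carrier_mat n n"
  unfolding K_def L_def L_adj_def D_inv_def K_inv_def by auto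

lemma innov_var_pos: "j < n \<Longrightarrow> innov_var j > 0"
  using contraction[of "j - 1"] by (auto simp: abs_square_less_1)

lemma L_mult:
  assumes "X \<in> carrier_mat n p"
  shows "L * X = mat n p (\<lambda>(j, k). X $$ (j, k) - (if j = 0 then 0 else \<kappa> j (j - 1) * X $$ (j - 1, k)))"
proof (rule eq_matI)
  fix j k assume "j < dim_row (mat n p (\<lambda>(j, k). X $$ (j, k) - (if j = 0 then 0 else \<kappa> j (j - 1) * X $$ (j - 1, k))))"
    "k < dim_col (mat n p (\<lambda>(j, k). X $$ (j, k) - (if j = 0 then 0 else \<kappa> j (j - 1) * X $$ (j - 1, k))))"
  then have jk: "j < n" "k < p" by auto
  then have "(L * X) $$ (j, k) = (\<Sum>i\<in>{0..<n}. (if i = j then 1 else if j = Suc i then - \<kappa> j i else 0) * X $$ (i, k))"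
    using assms by (auto simp: L_def scalar_prod_def intro!: sum.cong)
  also have "\<dots> = X $$ (j, k) - (if j = 0 then 0 else \<kappa> j (j - 1) * X $$ (j - 1, k))"
    by (rule sum_bidiagonal) (rule jk)
  finally show "(L * X) $$ (j, k) = mat n p (\<lambda>(j, k). X $$ (j, k) - (if j = 0 then 0 else \<kappa> j (j - 1) * X $$ (j - 1, k))) $$ (j, k)"
    using jk by simp
qed (use assms in \<open>auto simp: L_def\<close>)

lemma mult_L_adj:
  assumes "X \<in> carrier_mat p n"
  shows "X * L_adj = mat p n (\<lambda>(j, k). X $$ (j, k) - (if k = 0 then 0 else cnj (\<kappa> k (k - 1)) * X $$ (j, k - 1)))"
proof (rule eq_matI)
  fix j k assume "j < dim_row (mat p n (\<lambda>(j, k). X $$ (j, k) - (if k = 0 then 0 else cnj (\<kappa> k (k - 1)) * X $$ (j, k - 1))))"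
    "k < dim_col (mat p n (\<lambda>(j, k). X $$ (j, k) - (if k = 0 then 0 else cnj (\<kappa> k (k - 1)) * X $$ (j, k - 1))))"
  then have jk: "j < p" "k < n" by auto
  then have "(X * L_adj) $$ (j, k) = (\<Sum>i\<in>{0..<n}. (if i = k then 1 else if k = Suc i then - cnj (\<kappa> k i) else 0) * X $$ (j, i))"
    using assms by (auto simp: L_adj_def scalar_prod_def intro!: sum.cong)
  also have "\<dots> = X $$ (j, k) - (if k = 0 then 0 else cnj (\<kappa> k (k - 1)) * X $$ (j, k - 1))"
    by (rule sum_bidiagonal) (rule jk)
  finally show "(X * L_adj) $$ (j, k) = mat p n (\<lambda>(j, k). X $$ (j, k) - (if k = 0 then 0 else cnj (\<kappa> k (k - 1)) * X $$ (j, k - 1))) $$ (j, k)"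
    using jk by simp
qed (use assms in \<open>auto simp: L_adj_def\<close>)

lemma mult_D_inv:
  assumes "X \<in> carrier_mat p n"
  shows "X * D_inv = mat p n (\<lambda>(j, k). X $$ (j, k) * complex_of_real (1 / innov_var k))"
proof (rule eq_matI)
  fix j k assume "j < dim_row (mat p n (\<lambda>(j, k). X $$ (j, k) * complex_of_real (1 / innov_var k)))"
    "k < dim_col (mat p n (\<lambda>(j, k). X $$ (j, k) * complex_of_real (1 / innov_var k)))"
  then have jk: "j < p" "k < n" by auto
  then have "(X * D_inv) $$ (j, k) = (\<Sum>i\<in>{0..<n}. X $$ (j, i) * D_inv $$ (i, k))"
    using assms by (auto simp: D_inv_def scalar_prod_def)
  also have "\<dots> = (\<Sum>i\<in>{0..<n}. if i = k then X $$ (j, i) * complex_of_real (1 / innov_var i) else 0)"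
    using jk by (intro sum.cong) (auto simp: D_inv_def)
  also have "\<dots> = X $$ (j, k) * complex_of_real (1 / innov_var k)"
    using jk by (subst sum.delta) auto
  finally show "(X * D_inv) $$ (j, k) = mat p n (\<lambda>(j, k). X $$ (j, k) * complex_of_real (1 / innov_var k)) $$ (j, k)"
    using jk by simp
qed (use assms in \<open>auto simp: D_inv_def\<close>)

text \<open>\<open>L\<close> maps the observations to their innovations \<open>Y\<^sub>j - \<kappa> j (j-1) Y\<^sub>j\<^sub>-\<^sub>1\<close>, which are uncorrelated
  by the Markov property.\<close>

lemma LDL: "L * K * L_adj = mat n n (\<lambda>(j, k). if j = k then complex_of_real (innov_var j) else 0)"
proof -
  have LK: "L * K = mat n n (\<lambda>(j, k). \<kappa> j k - (if j = 0 then 0 else \<kappa> j (j - 1) * \<kappa> (j - 1) k))"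
    by (subst L_mult[of _ n]) (auto simp: K_def)
  \<comment> \<open>Subtracting the prediction from row \<open>j\<close> clears everything left of
    the diagonal, since \<open>markov\<close> passes through \<open>j - 1\<close>.\<close>
  have lower: "\<kappa> j k - (if j = 0 then 0 else \<kappa> j (j - 1) * \<kappa> (j - 1) k) = 0" if "k < j" "j < n" for j k
    using markov[of k "j - 1" j] that by auto
  have diagonal: "\<kappa> j j - (if j = 0 then 0 else \<kappa> j (j - 1) * \<kappa> (j - 1) j) = complex_of_real (innov_var j)"
    if "j < n" for j
  proof (cases j)
    case (Suc i)
    then have "\<kappa> i j = cnj (\<kappa> j i)" using hermitian[of j i] that by simp
    then show ?thesis using Suc diag[OF that] by (simp add: complex_norm_square[unfolded of_real_power])
  qed (use diag that in simp)
  \<comment> \<open>The Markov property transported by hermitian symmetry: right of the diagonal,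
    column \<open>k\<close> of the kernel is a multiple of column \<open>k - 1\<close>, so
    multiplication by \<open>L_adj\<close> clears that part too.\<close>
  have upper: "\<kappa> i k = cnj (\<kappa> k (k - 1)) * \<kappa> i (k - 1)" if "i < k" "k < n" for i k
    using markov[of i "k - 1" k] hermitian[of k i] hermitian[of "k - 1" i] that by auto
  show ?thesis
  proof (subst mult_L_adj[of _ n], unfold LK, goal_cases)
    case 2
    show ?case
    proof (rule eq_matI, goal_cases)
      case (1 j k)
      then have jk: "j < n" "k < n" by auto
      show ?case
      proof (cases j k rule: linorder_cases)
        case less
        then show ?thesis using jk upper[of j k] upper[of "j - 1" k] by (auto simp: algebra_simps)
      next
        case equal
        then show ?thesis using jk diagonal[of j] lower[of "j - 1" j] by auto
      next
        case greater
        then show ?thesis using jk lower[of k j] lower[of "k - 1" j] by auto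
      qed
    qed auto
  qed simp
qed

text \<open>The diagonalisation is grouped as a product of two square matrices equal to 1. One-sided
  inverses of square matrices are two-sided, so the factors commute, which yields the inverse
  without inverting \<open>L\<close>.\<close>

lemma K_inv: "K * K_inv = 1\<^sub>m n" "K_inv * K = 1\<^sub>m n"
proof -
  have "L * K * L_adj * D_inv = 1\<^sub>m n"
  proof (subst mult_D_inv[of _ n], unfold LDL, goal_cases)
    case 2
    show ?case using innov_var_pos by (intro eq_matI) (fastforce simp flip: of_real_mult)+
  qed simp
  then have "(L * K) * (L_adj * D_inv) = 1\<^sub>m n"
    by (simp add: assoc_mult_mat[of _ n n _ n _ n] mult_carrier_mat[of _ n n])
  then have "(L_adj * D_inv) * (L * K) = 1\<^sub>m n"
    by (rule mat_mult_left_right_inverse[rotated 2]) (simp_all add: mult_carrier_mat[of _ n n])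
  then show "K_inv * K = 1\<^sub>m n"
    unfolding K_inv_def by (simp add: assoc_mult_mat[of _ n n _ n _ n] mult_carrier_mat[of _ n n])
  then show "K * K_inv = 1\<^sub>m n"
    by (rule mat_mult_left_right_inverse[rotated 2]) simp_all
qed

text \<open>\<open>L\<close> maps the all-ones vector to the innovation means, so the quadratic form
  becomes a sum over uncorrelated innovations of squared mean over variance.\<close>

lemma ones_K_inv_ones:
  "mat 1 n (\<lambda>_. 1) * K_inv * mat n 1 (\<lambda>_. 1) =
    mat 1 1 (\<lambda>_. of_real (\<Sum>j<n. (cmod (innov_mean j))\<^sup>2 / innov_var j))"
proof -
  let ?u = "mat 1 n (\<lambda>_. 1) :: complex mat" and ?w = "mat n 1 (\<lambda>_. 1) :: complex mat"
  have uc: "?u \<in> carrier_mat 1 n" "?w \<in> carrier_mat n 1" by auto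
  have "?u * K_inv * ?w = ?u * L_adj * D_inv * (L * ?w)"
    unfolding K_inv_def
    by (simp add: assoc_mult_mat[of _ 1 n _ n _ n] assoc_mult_mat[of _ 1 n _ n _ 1]
        assoc_mult_mat[of _ n n _ n _ 1] assoc_mult_mat[of _ n n _ n _ n] mult_carrier_mat[of _ n n] mult_carrier_mat[of _ 1 n])
  also have "L * ?w = mat n 1 (\<lambda>(j, _). innov_mean j)"
    by (subst L_mult[OF uc(2)]) auto
  also have "?u * L_adj * D_inv = mat 1 n (\<lambda>(_, k). cnj (innov_mean k) * complex_of_real (1 / innov_var k))"
    by (subst mult_L_adj[OF uc(1)], subst mult_D_inv[of _ 1]) auto
  also have "\<dots> * mat n 1 (\<lambda>(j, _). innov_mean j)
      = mat 1 1 (\<lambda>_. \<Sum>j\<in>{0..<n}. cnj (innov_mean j) * complex_of_real (1 / innov_var j) * innov_mean j)"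
    by (rule eq_matI) (auto simp: scalar_prod_def)
  also have "(\<Sum>j\<in>{0..<n}. cnj (innov_mean j) * complex_of_real (1 / innov_var j) * innov_mean j)
      = of_real (\<Sum>j<n. (cmod (innov_mean j))\<^sup>2 / innov_var j)"
    unfolding of_real_sum lessThan_atLeast0
    by (rule sum.cong) (simp_all add: complex_norm_square[unfolded of_real_power] mult.commute)
  finally show ?thesis .
qed

lemma det_fisher_information:
  assumes C: "C_mat M Z n t = realify K"
  shows "Determinant.det (fisher_information M Z n t)
    = (\<Sum>j<n. (cmod (innov_mean j))\<^sup>2 / innov_var j)\<^sup>2"
proof -
  have "the (mat_inverse (realify K)) = realify K_inv"
    by (rule the_mat_inverse[of _ "2 * n"])
      (simp_all add: realify_carrier K_inv realify_one flip: realify_mult[of _ n n _ n])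
  then have "fisher_information M Z n t
      = realify (mat 1 n (\<lambda>_. 1)) * realify K_inv * realify (mat n 1 (\<lambda>_. 1))"
    unfolding fisher_information_def C realify_ones_row realify_ones_col by simp
  also have "\<dots> = realify (mat 1 n (\<lambda>_. 1) * K_inv * mat n 1 (\<lambda>_. 1))"
    by (subst realify_mult[of _ 1 n _ 1], simp_all add: mult_carrier_mat[of _ "Suc 0" n])
      (subst realify_mult[of _ 1 n _ n], simp_all)
  finally show ?thesis unfolding ones_K_inv_ones by (simp only: det_realify_of_real)
qed

end

section \<open>Integration and Brownian increments\<close>

text \<open>Passes from independent sigma-algebras, as in \<open>standard_brownian_motion\<close>,
  to independent random variables. The function \<open>h\<close> serves to embed a real increment
  into the complex numbers.\<close>

lemma (in prob_space) indep_var_of_indep_set: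
  assumes "indep_set (sets G) (sets (vimage_algebra (space M) V borel))"
    and "subalgebra M G" "U \<in> borel_measurable G"
    and V: "random_variable borel V" and h: "h \<in> borel_measurable borel"
  shows "indep_var borel U borel (h \<circ> V)"
proof -
  have G: "space G = space M" "sets G \<subseteq> events" using assms(2) by (auto simp: subalgebra_def)
  have U: "random_variable borel U"
    using measurable_from_subalg[OF assms(2,3)] .
  have "{U -` S \<inter> space M |S. S \<in> sets borel} \<subseteq> sets G"
    using measurable_sets[OF assms(3)] G(1) by auto
  then have 1: "sigma_sets (space M) {U -` S \<inter> space M |S. S \<in> sets borel} \<subseteq> sets G"
    using sets.sigma_sets_subset[of _ G] by (simp add: G(1))
  have hV: "h \<circ> V \<in> borel_measurable (vimage_algebra (space M) V borel)"
    by (rule measurable_comp[OF measurable_vimage_algebra1[of V "space M" borel] h]) simp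
  then have "{(h \<circ> V) -` S \<inter> space M |S. S \<in> sets borel} \<subseteq> sets (vimage_algebra (space M) V borel)"
    using measurable_sets[OF hV] by auto
  then have 2: "sigma_sets (space M) {(h \<circ> V) -` S \<inter> space M |S. S \<in> sets borel}
      \<subseteq> sets (vimage_algebra (space M) V borel)"
    using sets.sigma_sets_subset[of _ "vimage_algebra (space M) V borel"] by simp
  show ?thesis
    unfolding indep_var_eq
  proof (intro conjI U)
    show "random_variable borel (h \<circ> V)" using measurable_comp[OF V h] .
    show "indep_set (sigma_sets (space M) {U -` S \<inter> space M |S. S \<in> sets borel})
        (sigma_sets (space M) {(h \<circ> V) -` S \<inter> space M |S. S \<in> sets borel})"
      using assms(1) unfolding indep_set_def
      by (rule indep_sets_mono_sets) (use 1 2 in \<open>auto split: bool.split\<close>)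
  qed
qed

lemma (in prob_space) normal_moments:
  assumes "distributed M lborel X (normal_density 0 s)" "s > 0"
  shows "integrable M X" "expectation X = 0"
    "integrable M (\<lambda>\<xi>. (X \<xi>)\<^sup>2)" "expectation (\<lambda>\<xi>. (X \<xi>)\<^sup>2) = s\<^sup>2"
proof -
  show "integrable M X"
    using distributed_integrable[OF assms(1), of "\<lambda>x. x"] integrable_normal_moment_nz_1[OF assms(2), of 0]
    by simp
  show *: "expectation X = 0"
    by (rule normal_distributed_expectation[OF assms(2,1)])
  show "integrable M (\<lambda>\<xi>. (X \<xi>)\<^sup>2)"
    using distributed_integrable[OF assms(1), of "\<lambda>x. x\<^sup>2"] integrable_normal_moment[OF assms(2), of 0 2]
    by simp
  show "expectation (\<lambda>\<xi>. (X \<xi>)\<^sup>2) = s\<^sup>2"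
    using normal_distributed_variance[OF assms(2,1)] * by simp
qed

text \<open>For \<open>s = t\<close> the increment has no density but is identically zero. This case
  is included because time integrals start at the left end point.\<close>

lemma (in prob_space) brownian_increment:
  assumes W: "standard_brownian_motion M F W" and st: "0 \<le> s" "s \<le> t"
  shows "integrable M (\<lambda>\<xi>. W t \<xi> - W s \<xi>)" "expectation (\<lambda>\<xi>. W t \<xi> - W s \<xi>) = 0"
    "integrable M (\<lambda>\<xi>. (W t \<xi> - W s \<xi>)\<^sup>2)" "expectation (\<lambda>\<xi>. (W t \<xi> - W s \<xi>)\<^sup>2) = t - s"
proof -
  have d: "distributed M lborel (\<lambda>\<xi>. W t \<xi> - W s \<xi>) (normal_density 0 (sqrt (t - s)))" if "s < t"
    using W st that by (auto simp: standard_brownian_motion_def)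
  show "integrable M (\<lambda>\<xi>. W t \<xi> - W s \<xi>)" "expectation (\<lambda>\<xi>. W t \<xi> - W s \<xi>) = 0"
    "integrable M (\<lambda>\<xi>. (W t \<xi> - W s \<xi>)\<^sup>2)" "expectation (\<lambda>\<xi>. (W t \<xi> - W s \<xi>)\<^sup>2) = t - s"
    using normal_moments[OF d] st by (cases "s = t"; simp)+
qed

lemma (in prob_space) brownian_increment_orthogonal:
  fixes X :: "'a \<Rightarrow> complex"
  assumes W: "standard_brownian_motion M F W" and st: "0 \<le> s" "s \<le> t"
    and F: "\<And>r. r \<ge> 0 \<Longrightarrow> subalgebra M (F r)"
    and X: "X \<in> borel_measurable (F s)" "integrable M X"
  shows "integrable M (\<lambda>\<xi>. X \<xi> * of_real (W t \<xi> - W s \<xi>))"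
    "expectation (\<lambda>\<xi>. X \<xi> * of_real (W t \<xi> - W s \<xi>)) = 0"
proof -
  have *: "integrable M (\<lambda>\<xi>. X \<xi> * of_real (W t \<xi> - W s \<xi>)) \<and>
    expectation (\<lambda>\<xi>. X \<xi> * of_real (W t \<xi> - W s \<xi>)) = 0" if "s < t"
  proof -
    let ?V = "\<lambda>\<xi>. W t \<xi> - W s \<xi>"
    note b = brownian_increment[OF W st]
    have "indep_set (sets (F s)) (sets (vimage_algebra (space M) ?V borel))"
      using W st that by (auto simp: standard_brownian_motion_def)
    from indep_var_of_indep_set[OF this F[OF st(1)] X(1), of complex_of_real]
    have "indep_var borel X borel (\<lambda>\<xi>. complex_of_real (?V \<xi>))"
      using b(1) by (simp add: comp_def)
    from indep_var_integrable[OF this X(2)] indep_var_lebesgue_integral[OF this X(2)]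
    show ?thesis
      using b(1,2) by (simp add: integral_complex_of_real del: of_real_diff)
  qed
  show "integrable M (\<lambda>\<xi>. X \<xi> * of_real (W t \<xi> - W s \<xi>))"
    "expectation (\<lambda>\<xi>. X \<xi> * of_real (W t \<xi> - W s \<xi>)) = 0"
    using * st by (cases "s = t"; auto)+
qed

section \<open>Pathwise solution of the linear equation and time integrals of continuous
  processes\<close>

lemma linear_ode_solution:
  fixes y w :: "real \<Rightarrow> complex"
  assumes st: "s \<le> t" and cy: "continuous_on {s..t} y"
    and eq: "\<And>u. u \<in> {s..t} \<Longrightarrow> y u = y s - a * integral {s..u} y + w u"
  shows "y t = exp (- (a * of_real (t - s))) * y s + w t
    - a * integral {s..t} (\<lambda>u. exp (- (a * of_real (t - u))) * w u)"
proof -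
  \<comment> \<open>Variation of constants with the noise integrated by parts: \<open>H\<close> is
    the integrating factor times \<open>a * I u - y s\<close>, and the integral equation makes its
    derivative \<open>a * (E u * w u)\<close>. Thus \<open>w\<close> is integrated and never
    differentiated, as Brownian paths require.\<close>
  define E where "E u = exp (- (a * of_real (t - u)))" for u
  define I where "I u = integral {s..u} y" for u
  define H where "H u = E u * (a * I u - y s)" for u
  have E': "(E has_vector_derivative a * E u) (at u within {s..t})" for u
  proof -
    have "((\<lambda>z. exp (- (a * (of_real t - z)))) has_field_derivative a * E u) (at (of_real u))"
      unfolding E_def by (auto intro!: derivative_eq_intros)
    from has_vector_derivative_real_field[OF this] show ?thesis
      unfolding E_def by simp
  qed
  have "(H has_vector_derivative a * (E u * w u)) (at u within {s..t})" if u: "u \<in> {s..t}" for u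
  proof -
    have "(I has_vector_derivative y u) (at u within {s..t})"
      unfolding I_def by (rule integral_has_vector_derivative[OF cy u])
    then have "((\<lambda>u. a * I u - y s) has_vector_derivative a * y u) (at u within {s..t})"
      by (auto intro!: derivative_eq_intros)
    from has_vector_derivative_mult[OF E' this]
    have "(H has_vector_derivative E u * (a * y u) + a * E u * (a * I u - y s)) (at u within {s..t})"
      unfolding H_def .
    moreover have w: "w u = y u + a * I u - y s" using eq[OF u] by (simp add: I_def)
    have "E u * (a * y u) + a * E u * (a * I u - y s) = a * (E u * w u)"
      unfolding w by (simp add: algebra_simps)
    ultimately show ?thesis by simp
  qed
  then have "((\<lambda>u. a * (E u * w u)) has_integral H t - H s) {s..t}"
    by (rule fundamental_theorem_of_calculus[OF st])
  then have "integral {s..t} (\<lambda>u. a * (E u * w u)) = H t - H s"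
    by (rule integral_unique)
  then have "a * integral {s..t} (\<lambda>u. E u * w u) = H t - H s"
    by simp
  also have "\<dots> = a * I t - y s + exp (- (a * of_real (t - s))) * y s"
    by (simp add: H_def E_def I_def algebra_simps)
  finally have J: "a * integral {s..t} (\<lambda>u. E u * w u) = \<dots>" .
  have "y t = y s - a * I t + w t" using eq[of t] st by (simp add: I_def)
  then show ?thesis
    unfolding J[unfolded E_def] by simp
qed

text \<open>Rounding time down to a grid of mesh \<open>1 / real (Suc i)\<close> gives functions
  assembled from countably many measurable slices; continuity of the paths makes them
  converge.\<close>

lemma continuous_process_jointly_measurable:
  fixes V :: "real \<Rightarrow> 'a \<Rightarrow> 'b::{metric_space, second_countable_topology}"
  assumes st: "s \<le> t" and V: "\<And>u. u \<in> {s..t} \<Longrightarrow> V u \<in> borel_measurable M"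
    and cont: "\<And>\<xi>. \<xi> \<in> space M \<Longrightarrow> continuous_on {s..t} (\<lambda>u. V u \<xi>)"
  shows "(\<lambda>(u, \<xi>). V u \<xi>) \<in> borel_measurable (restrict_space lborel {s..t} \<Otimes>\<^sub>M M)"
proof (rule borel_measurable_LIMSEQ_metric)
  \<comment> \<open>Rounding down can leave the interval, so times are clamped to it; clamping also
    makes each path continuous on the whole line.\<close>
  define c where "c u = max s (min t u)" for u
  have c: "c u \<in> {s..t}" for u using st by (auto simp: c_def)
  let ?N = "restrict_space lborel {s..t}"
  let ?f = "\<lambda>i p. V (c (of_int \<lfloor>real (Suc i) * fst p\<rfloor> / real (Suc i))) (snd p)"
  show "?f i \<in> borel_measurable (?N \<Otimes>\<^sub>M M)" for i
  proof (rule measurable_compose_countable[where f="\<lambda>k p. V (c (of_int k / real (Suc i))) (snd p)"])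
    show "(\<lambda>p. V (c (of_int k / real (Suc i))) (snd p)) \<in> borel_measurable (?N \<Otimes>\<^sub>M M)" for k
      by (rule measurable_compose[OF measurable_snd V[OF c]])
    have "fst \<in> borel_measurable (?N \<Otimes>\<^sub>M M)"
      by (rule measurable_compose[OF measurable_fst]) (auto intro: measurable_restrict_space1)
    then show "(\<lambda>p. \<lfloor>real (Suc i) * fst p\<rfloor>) \<in> ?N \<Otimes>\<^sub>M M \<rightarrow>\<^sub>M count_space UNIV"
      by measurable
  qed
  fix p assume "p \<in> space (?N \<Otimes>\<^sub>M M)"
  then have p: "fst p \<in> {s..t}" "snd p \<in> space M"
    by (auto simp: space_pair_measure space_restrict_space)
  have "(\<lambda>i. of_int \<lfloor>real (Suc i) * fst p\<rfloor> / real (Suc i)) \<longlonglongrightarrow> fst p"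
  proof (rule tendsto_sandwich)
    show "(\<lambda>i. fst p - inverse (real (Suc i))) \<longlonglongrightarrow> fst p"
      using tendsto_diff[OF tendsto_const LIMSEQ_inverse_real_of_nat] by simp
    have "fst p - inverse (real (Suc i)) \<le> of_int \<lfloor>real (Suc i) * fst p\<rfloor> / real (Suc i)" for i
    proof -
      have "real (Suc i) * fst p - 1 \<le> of_int \<lfloor>real (Suc i) * fst p\<rfloor>" by linarith
      then have "(real (Suc i) * fst p - 1) / real (Suc i) \<le> of_int \<lfloor>real (Suc i) * fst p\<rfloor> / real (Suc i)"
        by (rule divide_right_mono) simp
      moreover have k: "(N * x - 1) / N = x - inverse N" if "N > 0" for N x :: real
        using that by (simp add: field_simps)
      have "(real (Suc i) * fst p - 1) / real (Suc i) = fst p - inverse (real (Suc i))"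
        by (rule k) simp
      ultimately show ?thesis by (simp only:)
    qed
    then show "\<forall>\<^sub>F i in sequentially. fst p - inverse (real (Suc i)) \<le> of_int \<lfloor>real (Suc i) * fst p\<rfloor> / real (Suc i)"
      by simp
    have "of_int \<lfloor>real (Suc i) * fst p\<rfloor> / real (Suc i) \<le> fst p" for i
    proof -
      have "of_int \<lfloor>real (Suc i) * fst p\<rfloor> \<le> real (Suc i) * fst p" by linarith
      then show ?thesis by (simp add: field_simps)
    qed
    then show "\<forall>\<^sub>F i in sequentially. of_int \<lfloor>real (Suc i) * fst p\<rfloor> / real (Suc i) \<le> fst p"
      by simp
  qed (rule tendsto_const)
  moreover have "continuous_on UNIV (\<lambda>u. V (c u) (snd p))"
    by (rule continuous_on_compose2[OF cont[OF p(2)]])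
      (use c in \<open>auto simp: c_def intro!: continuous_intros\<close>)
  ultimately have "(\<lambda>i. ?f i p) \<longlonglongrightarrow> V (c (fst p)) (snd p)"
    by (intro continuous_on_tendsto_compose[where f="\<lambda>u. V (c u) (snd p)" and s=UNIV]) auto
  moreover have "c (fst p) = fst p" using p by (auto simp: c_def)
  ultimately show "(\<lambda>i. ?f i p) \<longlonglongrightarrow> (case p of (u, \<xi>) \<Rightarrow> V u \<xi>)"
    by (simp add: case_prod_beta)
qed

lemma finite_measure_restrict_lborel: "finite_measure (restrict_space lborel {s..t::real})"
  by (rule finite_measureI) (simp add: emeasure_restrict_space space_restrict_space emeasure_lborel_Icc_eq)

lemma measure_restrict_lborel: "s \<le> t \<Longrightarrow> measure (restrict_space lborel {s..t::real}) {s..t} = t - s"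
  by (simp add: measure_restrict_space)

text \<open>Links the two integrals in play: Henstock-Kurzweil in the integral equation, and
  Lebesgue on a restricted measure for Fubini's theorem.\<close>

lemma integral_restrict_lborel:
  fixes f :: "real \<Rightarrow> complex"
  assumes "continuous_on {s..t} f"
  shows "integrable (restrict_space lborel {s..t}) f"
    and "(LINT u|restrict_space lborel {s..t}. f u) = integral {s..t} f"
proof -
  have f: "set_integrable lborel {s..t} f" by (rule borel_integrable_atLeastAtMost'[OF assms])
  then show "integrable (restrict_space lborel {s..t}) f"
    by (simp add: integrable_restrict_space set_integrable_def)
  show "(LINT u|restrict_space lborel {s..t}. f u) = integral {s..t} f"
    using set_borel_integral_eq_integral(2)[OF f]
    by (simp add: integral_restrict_space set_lebesgue_integral_def)
qed

text \<open>Cauchy-Schwarz, from the nonnegativity of the integrated squared deviation of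
  \<open>cmod (f u)\<close> from its average \<open>c\<close>.\<close>

lemma norm_integral_square_le:
  fixes f :: "real \<Rightarrow> complex"
  assumes st: "s < t" and f: "integrable (restrict_space lborel {s..t}) f"
    and f2: "integrable (restrict_space lborel {s..t}) (\<lambda>u. (cmod (f u))\<^sup>2)"
  shows "(cmod (LINT u|restrict_space lborel {s..t}. f u))\<^sup>2
    \<le> (t - s) * (LINT u|restrict_space lborel {s..t}. (cmod (f u))\<^sup>2)"
proof -
  let ?N = "restrict_space lborel {s..t}"
  interpret N: finite_measure ?N by (rule finite_measure_restrict_lborel)
  define A where "A = (LINT u|?N. cmod (f u))"
  define S where "S = (LINT u|?N. (cmod (f u))\<^sup>2)"
  define c where "c = A / (t - s)"
  have "0 \<le> (LINT u|?N. (cmod (f u) - c)\<^sup>2)" by simp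
  also have "\<dots> = (LINT u|?N. (cmod (f u))\<^sup>2 - 2 * c * cmod (f u) + c\<^sup>2)"
    by (simp add: power2_diff algebra_simps)
  also have "\<dots> = S - 2 * c * A + c\<^sup>2 * (t - s)"
    using f f2 measure_restrict_lborel[of s t] st by (simp add: S_def A_def space_restrict_space)
  finally have nonneg: "0 \<le> S - 2 * c * A + c\<^sup>2 * (t - s)" .
  have cT: "c * (t - s) = A" using st by (simp add: c_def)
  have "c\<^sup>2 * (t - s) = c * A" unfolding power2_eq_square mult.assoc cT ..
  then have "c * A \<le> S" using nonneg by linarith
  then have "(t - s) * (c * A) \<le> (t - s) * S" using st by (intro mult_left_mono) auto
  moreover have "(t - s) * (c * A) = c * (t - s) * A" by (simp add: algebra_simps)
  then have "(t - s) * (c * A) = A\<^sup>2" unfolding cT power2_eq_square .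
  ultimately have "A\<^sup>2 \<le> (t - s) * S" by simp
  moreover have "cmod (LINT u|?N. f u) \<le> A"
    unfolding A_def by (rule integral_norm_bound)
  ultimately show ?thesis
    unfolding S_def by (meson norm_ge_zero order_trans power_mono)
qed

text \<open>Tonelli: a bound on the expected norm that is uniform over a bounded time interval has a
  finite time integral.\<close>

lemma (in prob_space) integrable_product_if_bounded:
  fixes f :: "real \<times> 'a \<Rightarrow> 'b :: {banach, second_countable_topology}"
  assumes f: "f \<in> borel_measurable (restrict_space lborel {s..t} \<Otimes>\<^sub>M M)"
    and int: "\<And>u. u \<in> {s..t} \<Longrightarrow> integrable M (\<lambda>\<xi>. f (u, \<xi>))"
    and B: "\<And>u. u \<in> {s..t} \<Longrightarrow> expectation (\<lambda>\<xi>. norm (f (u, \<xi>))) \<le> B"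
  shows "integrable (restrict_space lborel {s..t} \<Otimes>\<^sub>M M) f"
proof -
  let ?N = "restrict_space lborel {s..t}"
  interpret N: finite_measure ?N by (rule finite_measure_restrict_lborel)
  interpret P: pair_sigma_finite ?N M ..
  have [measurable]: "f \<in> borel_measurable (?N \<Otimes>\<^sub>M M)" by (rule f)
  show ?thesis
  proof (rule P.Fubini_integrable[OF f])
    show "integrable ?N (\<lambda>u. expectation (\<lambda>\<xi>. norm (f (u, \<xi>))))"
    proof (rule N.integrable_const_bound[of _ B])
      show "AE u in ?N. norm (expectation (\<lambda>\<xi>. norm (f (u, \<xi>)))) \<le> B"
        using B by (intro AE_I2) (simp add: space_restrict_space)
      show "(\<lambda>u. expectation (\<lambda>\<xi>. norm (f (u, \<xi>)))) \<in> borel_measurable ?N"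
        by measurable
    qed
    show "AE u in ?N. integrable M (\<lambda>\<xi>. f (u, \<xi>))"
      using int by (intro AE_I2) (simp add: space_restrict_space)
  qed
qed

section \<open>Square-integrable complex random variables\<close>

definition square_integrable :: "'a measure \<Rightarrow> ('a \<Rightarrow> complex) \<Rightarrow> bool" where
  "square_integrable M X \<longleftrightarrow> X \<in> borel_measurable M \<and> integrable M (\<lambda>\<xi>. (cmod (X \<xi>))\<^sup>2)"

lemma norm_mult_le_sum_squares: "cmod (x * y) \<le> (cmod x)\<^sup>2 + (cmod y)\<^sup>2"
proof -
  have "cmod (x * y) \<le> 2 * cmod x * cmod y" by (simp add: norm_mult)
  also have "\<dots> \<le> (cmod x)\<^sup>2 + (cmod y)\<^sup>2" by (rule sum_squares_bound)
  finally show ?thesis .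
qed

lemma square_integrable_mult:
  assumes "square_integrable M X" "square_integrable M Y"
  shows "integrable M (\<lambda>\<xi>. X \<xi> * Y \<xi>)"
proof (rule Bochner_Integration.integrable_bound)
  show "integrable M (\<lambda>\<xi>. (cmod (X \<xi>))\<^sup>2 + (cmod (Y \<xi>))\<^sup>2)" "(\<lambda>\<xi>. X \<xi> * Y \<xi>) \<in> borel_measurable M"
    using assms by (auto simp: square_integrable_def)
  show "AE \<xi> in M. norm (X \<xi> * Y \<xi>) \<le> norm ((cmod (X \<xi>))\<^sup>2 + (cmod (Y \<xi>))\<^sup>2)"
    using norm_mult_le_sum_squares by simp
qed

lemma square_integrable_cnj: "square_integrable M X \<Longrightarrow> square_integrable M (\<lambda>\<xi>. cnj (X \<xi>))"
  by (auto simp: square_integrable_def intro: borel_measurable_continuous_on[OF continuous_on_cnj[OF continuous_on_id]])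

lemma square_integrable_cmult: "square_integrable M X \<Longrightarrow> square_integrable M (\<lambda>\<xi>. c * X \<xi>)"
  by (auto simp: square_integrable_def norm_mult power_mult_distrib)

lemma square_integrable_add:
  assumes "square_integrable M X" "square_integrable M Y"
  shows "square_integrable M (\<lambda>\<xi>. X \<xi> + Y \<xi>)"
  unfolding square_integrable_def
proof
  show "(\<lambda>\<xi>. X \<xi> + Y \<xi>) \<in> borel_measurable M" using assms by (auto simp: square_integrable_def)
  show "integrable M (\<lambda>\<xi>. (cmod (X \<xi> + Y \<xi>))\<^sup>2)"
  proof (rule Bochner_Integration.integrable_bound)
    show "integrable M (\<lambda>\<xi>. 2 * (cmod (X \<xi>))\<^sup>2 + 2 * (cmod (Y \<xi>))\<^sup>2)"
      "(\<lambda>\<xi>. (cmod (X \<xi> + Y \<xi>))\<^sup>2) \<in> borel_measurable M"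
      using assms by (auto simp: square_integrable_def)
    have "(cmod (x + y))\<^sup>2 \<le> 2 * (cmod x)\<^sup>2 + 2 * (cmod y)\<^sup>2" for x y
    proof -
      have "(cmod (x + y))\<^sup>2 \<le> (cmod x + cmod y)\<^sup>2" by (intro power_mono norm_triangle_ineq) simp
      also have "\<dots> \<le> 2 * (cmod x)\<^sup>2 + 2 * (cmod y)\<^sup>2"
        using sum_squares_bound[of "cmod x" "cmod y"] by (simp add: power2_sum)
      finally show ?thesis .
    qed
    then show "AE \<xi> in M. norm ((cmod (X \<xi> + Y \<xi>))\<^sup>2) \<le> norm (2 * (cmod (X \<xi>))\<^sup>2 + 2 * (cmod (Y \<xi>))\<^sup>2)"
      by simp
  qed
qed

lemma square_integrable_diff:
  assumes "square_integrable M X" "square_integrable M Y"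
  shows "square_integrable M (\<lambda>\<xi>. X \<xi> - Y \<xi>)"
  using square_integrable_add[OF assms(1) square_integrable_cmult[OF assms(2), of "-1"]] by simp

lemma (in prob_space) square_integrable_const: "square_integrable M (\<lambda>_. c)"
  by (simp add: square_integrable_def)

lemma (in prob_space) square_integrable_integrable: "square_integrable M X \<Longrightarrow> integrable M X"
  using square_integrable_mult[OF _ square_integrable_const[of 1], of X] by simp

text \<open>Young's inequality with a free weight, from the square of
  \<open>c * cmod x - cmod y\<close>. The weight balances factors of different orders of
  smallness.\<close>

lemma norm_mult_le_weighted:
  fixes x y :: complex
  assumes "c > 0"
  shows "cmod (x * y) \<le> (c * (cmod x)\<^sup>2 + (cmod y)\<^sup>2 / c) / 2"
proof -
  have "0 \<le> (c * cmod x - cmod y)\<^sup>2 / c" using assms by simp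
  also have "\<dots> = c * (cmod x)\<^sup>2 - 2 * (cmod x * cmod y) + (cmod y)\<^sup>2 / c"
    using assms by (simp add: field_simps power2_eq_square)
  finally show ?thesis by (simp add: norm_mult)
qed

text \<open>A contraction argument: \<open>E min(V, K)\<close> is bounded uniformly in \<open>K\<close> because
  \<open>E min(c V, K) \<le> E min(c q V, K) + c E B\<close> can be iterated along \<open>c = q\<^sup>i\<close>.\<close>

lemma (in prob_space) integrable_if_contractive:
  fixes V V' B :: "'a \<Rightarrow> real"
  assumes V: "V \<in> borel_measurable M" "\<And>\<xi>. V \<xi> \<ge> 0" and V': "V' \<in> borel_measurable M"
    and B: "integrable M B" "\<And>\<xi>. B \<xi> \<ge> 0"
    and law: "distr M borel V' = distr M borel V"
    and q: "0 \<le> q" "q < 1" and le: "AE \<xi> in M. V' \<xi> \<le> q * V \<xi> + B \<xi>"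
  shows "integrable M V"
proof -
  define b where "b = expectation B"
  have b: "b \<ge> 0" unfolding b_def using B by simp
  \<comment> \<open>Truncation at \<open>K\<close> makes the expectations finite before
    integrability of \<open>V\<close> is known.\<close>
  have int: "integrable M (\<lambda>\<xi>. min (c * V \<xi>) K)" if "K \<ge> 0" "c \<ge> 0" for K c
  proof (rule integrable_const_bound[of _ K])
    have "c * V \<xi> \<ge> 0" for \<xi> using that V(2) by simp
    then show "AE \<xi> in M. norm (min (c * V \<xi>) K) \<le> K" using that(1) by simp
  qed (use V in measurable)
  have step: "expectation (\<lambda>\<xi>. min (c * V \<xi>) K) \<le> expectation (\<lambda>\<xi>. min (c * q * V \<xi>) K) + c * b"
    if K: "K \<ge> 0" "c \<ge> 0" for K c
  proof -
    have "expectation (\<lambda>\<xi>. min (c * V \<xi>) K) = (LINT v|distr M borel V. min (c * v) K)"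
      using V by (subst integral_distr) auto
    also have "\<dots> = expectation (\<lambda>\<xi>. min (c * V' \<xi>) K)"
      unfolding law[symmetric] using V' by (subst integral_distr) auto
    also have "\<dots> \<le> expectation (\<lambda>\<xi>. min (c * q * V \<xi>) K + c * B \<xi>)"
    proof (rule integral_mono_AE)
      have "integrable M (\<lambda>\<xi>. min (c * V \<xi>) K)" by (rule int[OF K])
      then have "integrable (distr M borel V) (\<lambda>v. min (c * v) K)"
        using V by (subst integrable_distr_eq) auto
      then show "integrable M (\<lambda>\<xi>. min (c * V' \<xi>) K)"
        unfolding law[symmetric] using V' by (subst (asm) integrable_distr_eq) auto
      show "integrable M (\<lambda>\<xi>. min (c * q * V \<xi>) K + c * B \<xi>)"
        using int[of K "c * q"] K q B by simp
      show "AE \<xi> in M. min (c * V' \<xi>) K \<le> min (c * q * V \<xi>) K + c * B \<xi>"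
        using le
      proof eventually_elim
        case (elim \<xi>)
        then have "c * V' \<xi> \<le> c * q * V \<xi> + c * B \<xi>"
          using mult_left_mono[OF elim K(2)] by (simp add: algebra_simps)
        moreover have "c * B \<xi> \<ge> 0" using B K by simp
        ultimately show ?case by (auto simp: min_def)
      qed
    qed
    also have "\<dots> = expectation (\<lambda>\<xi>. min (c * q * V \<xi>) K) + c * b"
      using int[of K "c * q"] K q B by (simp add: b_def)
    finally show ?thesis .
  qed
  have iter: "expectation (\<lambda>\<xi>. min (V \<xi>) K) \<le> expectation (\<lambda>\<xi>. min (q ^ i * V \<xi>) K) + (1 - q ^ i) / (1 - q) * b"
    if "K \<ge> 0" for K i
  proof (induction i)
    case (Suc i)
    \<comment> \<open>Geometric partial sum: the i-th step is taken with scale \<open>q ^ i\<close>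
      and adds \<open>q ^ i * b\<close>.\<close>
    have "(1 - q ^ i) / (1 - q) * b + q ^ i * b = (1 - q ^ Suc i) / (1 - q) * b"
      using q by (simp add: field_simps)
    then show ?case using Suc step[OF that, of "q ^ i"] q by (simp add: mult.commute)
  qed simp
  have bound: "expectation (\<lambda>\<xi>. min (V \<xi>) K) \<le> b / (1 - q)" if K: "K \<ge> 0" for K
  proof -
    \<comment> \<open>The scaled variable tends to 0 pointwise under the constant bound
      \<open>K\<close>; in the limit only the geometric series remains, a bound free of
      \<open>K\<close>.\<close>
    have "(\<lambda>i. expectation (\<lambda>\<xi>. min (q ^ i * V \<xi>) K)) \<longlonglongrightarrow> expectation (\<lambda>\<xi>. 0)"
    proof (rule integral_dominated_convergence[where w="\<lambda>_. K"])
      show "AE \<xi> in M. (\<lambda>i. min (q ^ i * V \<xi>) K) \<longlonglongrightarrow> 0"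
      proof (rule AE_I2)
        fix \<xi>
        have "(\<lambda>i. min (q ^ i * V \<xi>) K) \<longlonglongrightarrow> min (0 * V \<xi>) K"
          using q by (intro tendsto_intros LIMSEQ_power_zero) auto
        then show "(\<lambda>i. min (q ^ i * V \<xi>) K) \<longlonglongrightarrow> 0" using K by simp
      qed
      show "AE \<xi> in M. norm (min (q ^ i * V \<xi>) K) \<le> K" for i
      proof -
        have "q ^ i * V \<xi> \<ge> 0" for \<xi> using V(2) q by simp
        then show ?thesis using K by simp
      qed
    qed (use V in auto)
    moreover have "(\<lambda>i. (1 - q ^ i) / (1 - q) * b) \<longlonglongrightarrow> (1 - 0) / (1 - q) * b"
      using q by (intro tendsto_intros LIMSEQ_power_zero) auto
    ultimately have "(\<lambda>i. expectation (\<lambda>\<xi>. min (q ^ i * V \<xi>) K) + (1 - q ^ i) / (1 - q) * b) \<longlonglongrightarrow> 0 + b / (1 - q)"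
      using tendsto_add by fastforce
    then show ?thesis
      using iter[OF K] by (intro LIMSEQ_le_const[of _ "b / (1 - q)"]) auto
  qed
  \<comment> \<open>Monotone convergence over integer truncation levels turns the uniform bound into
    integrability.\<close>
  have "(\<integral>\<^sup>+\<xi>. ennreal (V \<xi>) \<partial>M) = (SUP i. \<integral>\<^sup>+\<xi>. ennreal (min (V \<xi>) (real i)) \<partial>M)"
  proof -
    have "ennreal (V \<xi>) = (SUP i. ennreal (min (V \<xi>) (real i)))" for \<xi>
    proof (rule antisym)
      obtain i where "V \<xi> \<le> real i" using real_arch_simple by blast
      then show "ennreal (V \<xi>) \<le> (SUP i. ennreal (min (V \<xi>) (real i)))"
        by (intro SUP_upper2[of i]) auto
    qed (auto intro!: SUP_least ennreal_leI)
    then have "(\<integral>\<^sup>+\<xi>. ennreal (V \<xi>) \<partial>M) = (\<integral>\<^sup>+\<xi>. (SUP i. ennreal (min (V \<xi>) (real i))) \<partial>M)"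
      by simp
    also have "\<dots> = (SUP i. \<integral>\<^sup>+\<xi>. ennreal (min (V \<xi>) (real i)) \<partial>M)"
      using V by (intro nn_integral_monotone_convergence_SUP)
        (auto simp: incseq_def le_fun_def intro!: ennreal_leI)
    finally show ?thesis .
  qed
  also have "\<dots> \<le> ennreal (b / (1 - q))"
  proof (rule SUP_least)
    fix i :: nat
    have "(\<integral>\<^sup>+\<xi>. ennreal (min (V \<xi>) (real i)) \<partial>M) = ennreal (expectation (\<lambda>\<xi>. min (V \<xi>) (real i)))"
      using int[of "real i" 1] V by (intro nn_integral_eq_integral) auto
    also have "\<dots> \<le> ennreal (b / (1 - q))" by (intro ennreal_leI bound) simp
    finally show "(\<integral>\<^sup>+\<xi>. ennreal (min (V \<xi>) (real i)) \<partial>M) \<le> ennreal (b / (1 - q))" .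
  qed
  also have "\<dots> < \<infinity>" by simp
  finally show ?thesis
    using V by (intro integrableI_bounded) simp_all
qed

text \<open>As \<open>f 0 = 0\<close>, the quotients f(h)/h from the right tend to \<open>D\<close>
  by differentiability and to \<open>c\<close> by the quadratic bound. The one-sided form suits
  estimates available for positive times.\<close>

lemma derivative_eq_if_quadratic_error:
  fixes f :: "real \<Rightarrow> complex"
  assumes f: "(f has_vector_derivative D) (at 0)" and f0: "f 0 = 0"
    and le: "\<And>\<tau>. 0 < \<tau> \<Longrightarrow> \<tau> \<le> 1 \<Longrightarrow> cmod (f \<tau> - of_real \<tau> * c) \<le> K * \<tau>\<^sup>2"
  shows "D = c"
proof -
  have lim: "((\<lambda>h. cmod (f h - of_real h * D) / \<bar>h\<bar>) \<longlongrightarrow> 0) (at_right 0)"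
    using f f0 by (auto simp: has_vector_derivative_def has_derivative_at scaleR_conv_of_real
        intro: tendsto_within_subset)
  have "((\<lambda>h. cmod (f h - of_real h * D) / \<bar>h\<bar> + K * h) \<longlongrightarrow> 0 + K * 0) (at_right 0)"
    by (intro tendsto_intros lim)
  moreover have "\<forall>\<^sub>F h in at_right 0. cmod (D - c) \<le> cmod (f h - of_real h * D) / \<bar>h\<bar> + K * h"
  proof (rule eventually_at_rightI[of 0 1])
    fix h :: real assume h: "h \<in> {0<..<1}"
    have "h * cmod (D - c) = cmod ((f h - of_real h * c) - (f h - of_real h * D))"
      using h by (simp add: norm_mult flip: right_diff_distrib)
    also have "\<dots> \<le> K * h\<^sup>2 + cmod (f h - of_real h * D)"
      using le[of h] h norm_triangle_ineq4[of "f h - of_real h * c" "f h - of_real h * D"] by simp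
    finally show "cmod (D - c) \<le> cmod (f h - of_real h * D) / \<bar>h\<bar> + K * h"
      using h by (simp add: field_simps power2_eq_square)
  qed simp
  ultimately have "cmod (D - c) \<le> 0 + K * 0"
    by (rule tendsto_lowerbound) simp
  then show ?thesis by simp
qed

section \<open>Second moments of the stationary process\<close>

locale complex_OU = prob_space M for M :: "'a measure" +
  fixes F :: "real \<Rightarrow> 'a measure" and W1 W2 :: "real \<Rightarrow> 'a \<Rightarrow> real"
    and lam \<omega> \<sigma> :: real and Y :: "real \<Rightarrow> 'a \<Rightarrow> complex"
  assumes lam_pos: "lam > 0"
    and OU: "stationary_complex_OU M F W1 W2 lam \<omega> \<sigma> Y"
begin

definition a :: complex where "a = of_real lam - \<i> * of_real \<omega>"

definition dW :: "real \<Rightarrow> real \<Rightarrow> 'a \<Rightarrow> complex" where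
  "dW s t \<xi> = of_real (W1 t \<xi> - W1 s \<xi>) + \<i> * of_real (W2 t \<xi> - W2 s \<xi>)"

definition R :: "real \<Rightarrow> real \<Rightarrow> 'a \<Rightarrow> complex" where
  "R s t \<xi> = (LINT u|restrict_space lborel {s..t}. exp (- (a * of_real (t - u))) * dW s u \<xi>)"

text \<open>The stochastic integral of \<open>\<sigma> * exp (- (a * of_real (t - u)))\<close>
  against complex Brownian motion in pathwise form: integration by parts leaves the increment and
  the ordinary time integral \<open>R\<close>.\<close>

definition innovation :: "real \<Rightarrow> real \<Rightarrow> 'a \<Rightarrow> complex" where
  "innovation s t \<xi> = of_real \<sigma> * (dW s t \<xi> - a * R s t \<xi>)"

lemma brownian: "standard_brownian_motion M F W1" "standard_brownian_motion M F W2"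
  and subalg: "t \<ge> 0 \<Longrightarrow> subalgebra M (F t)"
  and Y_adapted: "t \<ge> 0 \<Longrightarrow> Y t \<in> borel_measurable (F t)"
  and Y_continuous: "\<xi> \<in> space M \<Longrightarrow> continuous_on {0..} (\<lambda>t. Y t \<xi>)"
  and Y_eq: "AE \<xi> in M. \<forall>t\<ge>0. Y t \<xi> = Y 0 \<xi> - a * integral {0..t} (\<lambda>s. Y s \<xi>)
    + of_real \<sigma> * (of_real (W1 t \<xi>) + \<i> * of_real (W2 t \<xi>))"
  using OU by (auto simp: stationary_complex_OU_def a_def)

lemma Y_measurable: "t \<ge> 0 \<Longrightarrow> Y t \<in> borel_measurable M"
  by (rule measurable_from_subalg[OF subalg Y_adapted])

lemma W_measurable:
  assumes "t \<ge> 0"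
  shows "W1 t \<in> borel_measurable M" "W2 t \<in> borel_measurable M"
  using assms brownian
  by (auto simp: standard_brownian_motion_def intro: measurable_from_subalg[OF subalg[OF assms]])

lemma dW_measurable: "0 \<le> s \<Longrightarrow> s \<le> t \<Longrightarrow> dW s t \<in> borel_measurable M"
  unfolding dW_def using W_measurable[of s] W_measurable[of t] by simp

lemma dW_continuous: "0 \<le> s \<Longrightarrow> \<xi> \<in> space M \<Longrightarrow> continuous_on {s..t} (\<lambda>u. dW s u \<xi>)"
  using brownian unfolding dW_def standard_brownian_motion_def
  by (intro continuous_intros) (auto intro: continuous_on_subset)

lemma expectation_prod_increments:
  assumes st: "0 \<le> s" "s \<le> t"
  shows "integrable M (\<lambda>\<xi>. (W1 t \<xi> - W1 s \<xi>) * (W2 t \<xi> - W2 s \<xi>))"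
    "expectation (\<lambda>\<xi>. (W1 t \<xi> - W1 s \<xi>) * (W2 t \<xi> - W2 s \<xi>)) = 0"
proof -
  let ?h = "\<lambda>w. w t - w s :: real"
  have h: "?h \<in> borel_measurable (PiM {0..} (\<lambda>_. borel))"
    using st by (intro borel_measurable_diff measurable_component_singleton) auto
  have "indep_var (PiM {0..} (\<lambda>_. borel)) (\<lambda>\<xi>. \<lambda>t\<in>{0..}. W1 t \<xi>)
      (PiM {0..} (\<lambda>_. borel)) (\<lambda>\<xi>. \<lambda>t\<in>{0..}. W2 t \<xi>)"
    using OU by (simp add: stationary_complex_OU_def independent_processes_def)
  from indep_var_compose[OF this h h]
  have ind: "indep_var borel (\<lambda>\<xi>. W1 t \<xi> - W1 s \<xi>) borel (\<lambda>\<xi>. W2 t \<xi> - W2 s \<xi>)"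
    using st by (simp add: comp_def)
  note m = brownian_increment[OF brownian(1) st] brownian_increment[OF brownian(2) st]
  show "integrable M (\<lambda>\<xi>. (W1 t \<xi> - W1 s \<xi>) * (W2 t \<xi> - W2 s \<xi>))"
    by (rule indep_var_integrable[OF ind m(1,5)])
  show "expectation (\<lambda>\<xi>. (W1 t \<xi> - W1 s \<xi>) * (W2 t \<xi> - W2 s \<xi>)) = 0"
    using indep_var_lebesgue_integral[OF ind m(1,5)] m(2) by simp
qed

text \<open>\<open>W1\<close> and \<open>W2\<close> have equal increment variances, which cancel in
  the real part of the expected square; independence kills its imaginary part.\<close>

lemma dW_moments:
  assumes st: "0 \<le> s" "s \<le> t"
  shows "square_integrable M (dW s t)"
    and "expectation (\<lambda>\<xi>. (cmod (dW s t \<xi>))\<^sup>2) = 2 * (t - s)"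
    and "expectation (\<lambda>\<xi>. dW s t \<xi> * dW s t \<xi>) = 0"
proof -
  note m = brownian_increment[OF brownian(1) st] brownian_increment[OF brownian(2) st]
  have sq: "(cmod (dW s t \<xi>))\<^sup>2 = (W1 t \<xi> - W1 s \<xi>)\<^sup>2 + (W2 t \<xi> - W2 s \<xi>)\<^sup>2" for \<xi>
    by (simp add: dW_def cmod_power2)
  show "square_integrable M (dW s t)"
    unfolding square_integrable_def sq using m dW_measurable[OF st] by simp
  show "expectation (\<lambda>\<xi>. (cmod (dW s t \<xi>))\<^sup>2) = 2 * (t - s)"
    unfolding sq using m by simp
  have "dW s t \<xi> * dW s t \<xi> = of_real ((W1 t \<xi> - W1 s \<xi>)\<^sup>2 - (W2 t \<xi> - W2 s \<xi>)\<^sup>2)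
      + 2 * \<i> * of_real ((W1 t \<xi> - W1 s \<xi>) * (W2 t \<xi> - W2 s \<xi>))" for \<xi>
    by (simp add: dW_def complex_eq_iff power2_eq_square)
  then have "expectation (\<lambda>\<xi>. dW s t \<xi> * dW s t \<xi>)
      = expectation (\<lambda>\<xi>. of_real ((W1 t \<xi> - W1 s \<xi>)\<^sup>2 - (W2 t \<xi> - W2 s \<xi>)\<^sup>2)
        + 2 * \<i> * of_real ((W1 t \<xi> - W1 s \<xi>) * (W2 t \<xi> - W2 s \<xi>)))"
    by simp
  also have "\<dots> = of_real (expectation (\<lambda>\<xi>. (W1 t \<xi> - W1 s \<xi>)\<^sup>2 - (W2 t \<xi> - W2 s \<xi>)\<^sup>2))
      + 2 * \<i> * of_real (expectation (\<lambda>\<xi>. (W1 t \<xi> - W1 s \<xi>) * (W2 t \<xi> - W2 s \<xi>)))"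
    using m(3,7) expectation_prod_increments(1)[OF st]
    by (subst Bochner_Integration.integral_add)
      (simp_all only: integral_mult_right_zero integral_complex_of_real integrable_of_real
        Bochner_Integration.integrable_diff integrable_mult_right)
  also have "\<dots> = 0" using m(3,4,7,8) expectation_prod_increments(2)[OF st] by simp
  finally show "expectation (\<lambda>\<xi>. dW s t \<xi> * dW s t \<xi>) = 0" .
qed

lemma dW_orthogonal:
  assumes st: "0 \<le> s" "s \<le> t" and X: "X \<in> borel_measurable (F s)" "integrable M X"
  shows "expectation (\<lambda>\<xi>. X \<xi> * dW s t \<xi>) = 0"
proof -
  note o = brownian_increment_orthogonal[OF brownian(1) st subalg X] brownian_increment_orthogonal[OF brownian(2) st subalg X]
  have "expectation (\<lambda>\<xi>. X \<xi> * dW s t \<xi>) = expectation (\<lambda>\<xi>. X \<xi> * of_real (W1 t \<xi> - W1 s \<xi>)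
      + \<i> * (X \<xi> * of_real (W2 t \<xi> - W2 s \<xi>)))"
    unfolding dW_def by (simp add: algebra_simps)
  also have "\<dots> = expectation (\<lambda>\<xi>. X \<xi> * of_real (W1 t \<xi> - W1 s \<xi>))
      + \<i> * expectation (\<lambda>\<xi>. X \<xi> * of_real (W2 t \<xi> - W2 s \<xi>))"
    using o(1,3) by (subst Bochner_Integration.integral_add) (simp_all only: integral_mult_right_zero integrable_mult_right)
  finally show ?thesis using o(2,4) by (simp only:) simp
qed

lemma cmod_decay: "cmod (exp (- (a * of_real h))) = exp (- lam * h)"
  by (simp add: a_def)

text \<open>\<open>R\<close> is of smaller order than the Brownian increment: Cauchy-Schwarz in time
  contributes one factor \<open>t - s\<close>, integration over time a second, the variance of the
  increment a third. Orthogonality to the past is inherited from \<open>dW\<close> by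
  Fubini.\<close>

lemma memory_integral:
  assumes st: "0 \<le> s" "s < t"
  shows "square_integrable M (R s t)"
    and "expectation (\<lambda>\<xi>. (cmod (R s t \<xi>))\<^sup>2) \<le> 2 * (t - s) ^ 3"
    and "X \<in> borel_measurable (F s) \<Longrightarrow> square_integrable M X \<Longrightarrow> expectation (\<lambda>\<xi>. X \<xi> * R s t \<xi>) = 0"
proof -
  let ?N = "restrict_space lborel {s..t}"
  interpret N: finite_measure ?N by (rule finite_measure_restrict_lborel)
  interpret P: pair_sigma_finite ?N M ..
  define f where "f u \<xi> = exp (- (a * of_real (t - u))) * dW s u \<xi>" for u \<xi>
  have R: "R s t \<xi> = (LINT u|?N. f u \<xi>)" for \<xi> by (simp add: R_def f_def)
  have f_cont: "continuous_on {s..t} (\<lambda>u. f u \<xi>)" if "\<xi> \<in> space M" for \<xi>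
    unfolding f_def by (intro continuous_intros dW_continuous st that)
  have f_sq: "square_integrable M (f u)" if "u \<in> {s..t}" for u
    unfolding f_def using that st by (intro square_integrable_cmult dW_moments) auto
  have f_le: "expectation (\<lambda>\<xi>. (cmod (f u \<xi>))\<^sup>2) \<le> 2 * (t - s)" if u: "u \<in> {s..t}" for u
  proof -
    have "expectation (\<lambda>\<xi>. (cmod (f u \<xi>))\<^sup>2) = (exp (- lam * (t - u)))\<^sup>2 * (2 * (u - s))"
      using dW_moments(2)[of s u] u st unfolding f_def norm_mult cmod_decay power_mult_distrib by simp
    also have "\<dots> \<le> 1 * (2 * (t - s))"
      using u st lam_pos by (intro mult_mono power_le_one) auto
    finally show ?thesis by simp
  qed
  have f_meas [measurable]: "(\<lambda>(u, \<xi>). f u \<xi>) \<in> borel_measurable (?N \<Otimes>\<^sub>M M)"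
    using f_cont f_sq st by (intro continuous_process_jointly_measurable) (auto simp: square_integrable_def)
  have [measurable]: "(\<lambda>(\<xi>, u). f u \<xi>) \<in> borel_measurable (M \<Otimes>\<^sub>M ?N)"
    using measurable_pair_swap[OF f_meas] by simp
  have R_meas: "R s t \<in> borel_measurable M"
    unfolding R by measurable
  have f2: "integrable (?N \<Otimes>\<^sub>M M) (\<lambda>(u, \<xi>). (cmod (f u \<xi>))\<^sup>2)"
    by (rule integrable_product_if_bounded[where B="2 * (t - s)"])
      (use f_sq f_le in \<open>auto simp: square_integrable_def\<close>)
  have R_le: "(cmod (R s t \<xi>))\<^sup>2 \<le> (t - s) * (LINT u|?N. (cmod (f u \<xi>))\<^sup>2)" if \<xi>: "\<xi> \<in> space M" for \<xi>
  proof -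
    have "continuous_on {s..t} (\<lambda>u. complex_of_real ((cmod (f u \<xi>))\<^sup>2))"
      by (intro continuous_intros f_cont \<xi>)
    from integral_restrict_lborel(1)[OF this]
    have "integrable ?N (\<lambda>u. (cmod (f u \<xi>))\<^sup>2)"
      using integrable_Re by fastforce
    then show ?thesis
      unfolding R using st integral_restrict_lborel(1)[OF f_cont[OF \<xi>]]
      by (intro norm_integral_square_le)
  qed
  have int: "integrable M (\<lambda>\<xi>. (t - s) * (LINT u|?N. (cmod (f u \<xi>))\<^sup>2))"
    using P.integrable_snd[OF f2] by simp
  show R_sq: "square_integrable M (R s t)"
    unfolding square_integrable_def
  proof (intro conjI R_meas Bochner_Integration.integrable_bound[OF int])
    show "AE \<xi> in M. norm ((cmod (R s t \<xi>))\<^sup>2) \<le> norm ((t - s) * (LINT u|?N. (cmod (f u \<xi>))\<^sup>2))"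
      using R_le by (intro AE_I2) force
  qed (use R_meas in measurable)
  have "expectation (\<lambda>\<xi>. (cmod (R s t \<xi>))\<^sup>2) \<le> expectation (\<lambda>\<xi>. (t - s) * (LINT u|?N. (cmod (f u \<xi>))\<^sup>2))"
    using R_sq int R_le by (intro integral_mono) (auto simp: square_integrable_def)
  also have "\<dots> = (t - s) * (LINT u|?N. expectation (\<lambda>\<xi>. (cmod (f u \<xi>))\<^sup>2))"
    using P.Fubini_integral[OF f2] by simp
  also have "\<dots> \<le> (t - s) * (LINT u|?N. 2 * (t - s))"
    using st f_le P.integrable_fst[OF f2]
    by (intro mult_left_mono integral_mono) (auto simp: space_restrict_space)
  also have "\<dots> = 2 * (t - s) ^ 3"
    using st measure_restrict_lborel[of s t] by (simp add: space_restrict_space power3_eq_cube)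
  finally show "expectation (\<lambda>\<xi>. (cmod (R s t \<xi>))\<^sup>2) \<le> 2 * (t - s) ^ 3" .
  show "expectation (\<lambda>\<xi>. X \<xi> * R s t \<xi>) = 0" if XF: "X \<in> borel_measurable (F s)" and X: "square_integrable M X"
  proof -
    have [measurable]: "X \<in> borel_measurable M" using X by (simp add: square_integrable_def)
    have "integrable (?N \<Otimes>\<^sub>M M) (\<lambda>(u, \<xi>). X \<xi> * f u \<xi>)"
    proof (rule integrable_product_if_bounded[where B="expectation (\<lambda>\<xi>. (cmod (X \<xi>))\<^sup>2) + 2 * (t - s)"])
      fix u assume u: "u \<in> {s..t}"
      have i: "integrable M (\<lambda>\<xi>. X \<xi> * f u \<xi>)" by (rule square_integrable_mult[OF X f_sq[OF u]])
      then show "integrable M (\<lambda>\<xi>. case (u, \<xi>) of (u, \<xi>) \<Rightarrow> X \<xi> * f u \<xi>)" by simp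
      have "expectation (\<lambda>\<xi>. cmod (X \<xi> * f u \<xi>)) \<le> expectation (\<lambda>\<xi>. (cmod (X \<xi>))\<^sup>2 + (cmod (f u \<xi>))\<^sup>2)"
      proof (rule integral_mono)
        show "integrable M (\<lambda>\<xi>. cmod (X \<xi> * f u \<xi>))" using i by (rule integrable_norm)
        show "integrable M (\<lambda>\<xi>. (cmod (X \<xi>))\<^sup>2 + (cmod (f u \<xi>))\<^sup>2)"
          using X f_sq[OF u] by (simp add: square_integrable_def)
        fix \<xi>
        show "cmod (X \<xi> * f u \<xi>) \<le> (cmod (X \<xi>))\<^sup>2 + (cmod (f u \<xi>))\<^sup>2"
          by (rule norm_mult_le_sum_squares)
      qed
      also have "\<dots> = expectation (\<lambda>\<xi>. (cmod (X \<xi>))\<^sup>2) + expectation (\<lambda>\<xi>. (cmod (f u \<xi>))\<^sup>2)"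
        using X f_sq[OF u] by (simp add: square_integrable_def)
      finally show "expectation (\<lambda>\<xi>. norm (case (u, \<xi>) of (u, \<xi>) \<Rightarrow> X \<xi> * f u \<xi>))
          \<le> expectation (\<lambda>\<xi>. (cmod (X \<xi>))\<^sup>2) + 2 * (t - s)"
        using f_le[OF u] by simp
    qed measurable
    from P.Fubini_integral[OF this]
    have "expectation (\<lambda>\<xi>. LINT u|?N. X \<xi> * f u \<xi>) = (LINT u|?N. expectation (\<lambda>\<xi>. X \<xi> * f u \<xi>))" .
    also have "\<dots> = (LINT u|?N. 0)"
    proof (rule Bochner_Integration.integral_cong[OF refl])
      fix u assume "u \<in> space ?N"
      then have u: "s \<le> u" by (simp add: space_restrict_space)
      have "expectation (\<lambda>\<xi>. X \<xi> * f u \<xi>) = expectation (\<lambda>\<xi>. exp (- (a * of_real (t - u))) * (X \<xi> * dW s u \<xi>))"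
        by (simp only: f_def mult.left_commute)
      also have "\<dots> = 0"
        using dW_orthogonal[OF st(1) u XF square_integrable_integrable[OF X]] by simp
      finally show "expectation (\<lambda>\<xi>. X \<xi> * f u \<xi>) = 0" .
    qed
    finally show ?thesis unfolding R by simp
  qed
qed

end

text \<open>A suitable \<open>\<epsilon>\<close> keeps the first coefficient so close to 1 that a
  contraction acting on \<open>x\<close> remains one, at the price of a larger factor on
  \<open>y\<close>.\<close>

lemma norm_add_square_le_weighted:
  fixes x y :: complex
  assumes "\<epsilon> > 0"
  shows "(cmod (x + y))\<^sup>2 \<le> (1 + \<epsilon>) * (cmod x)\<^sup>2 + (1 + 1 / \<epsilon>) * (cmod y)\<^sup>2"
proof -
  have "(cmod (x + y))\<^sup>2 \<le> (cmod x + cmod y)\<^sup>2" by (intro power_mono norm_triangle_ineq) simp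
  also have "\<dots> = (cmod x)\<^sup>2 + (cmod y)\<^sup>2 + 2 * cmod (x * y)" by (simp add: power2_sum norm_mult)
  also have "\<dots> \<le> (cmod x)\<^sup>2 + (cmod y)\<^sup>2 + (\<epsilon> * (cmod x)\<^sup>2 + (cmod y)\<^sup>2 / \<epsilon>)"
    using norm_mult_le_weighted[OF assms, of x y] by simp
  finally show ?thesis by (simp add: algebra_simps)
qed

section \<open>Autoregressive form of the process and the moments it determines\<close>

context complex_OU
begin

abbreviation decay :: "real \<Rightarrow> complex" where "decay h \<equiv> exp (- (a * of_real h))"

text \<open>Subtracting the integral equations at \<open>u\<close> and \<open>s\<close> restarts the
  equation at time \<open>s\<close>, where \<open>linear_ode_solution\<close> applies path by path
  with noise \<open>of_real \<sigma> * dW s u \<xi>\<close>.\<close>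

lemma Y_solution:
  assumes st: "0 \<le> s" "s < t"
  shows "AE \<xi> in M. Y t \<xi> = decay (t - s) * Y s \<xi> + innovation s t \<xi>"
  using Y_eq AE_space
proof eventually_elim
  case (elim \<xi>)
  have cont: "continuous_on {u..v} (\<lambda>s. Y s \<xi>)" if "u \<ge> 0" for u v
    using Y_continuous[OF elim(2)] by (rule continuous_on_subset) (use that in auto)
  have "Y u \<xi> = Y s \<xi> - a * integral {s..u} (\<lambda>s. Y s \<xi>) + of_real \<sigma> * dW s u \<xi>" if u: "u \<in> {s..t}" for u
  proof -
    let ?w = "\<lambda>u. complex_of_real (W1 u \<xi>) + \<i> * of_real (W2 u \<xi>)"
    have I: "integral {0..u} (\<lambda>s. Y s \<xi>) = integral {0..s} (\<lambda>s. Y s \<xi>) + integral {s..u} (\<lambda>s. Y s \<xi>)"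
      using st u by (intro Henstock_Kurzweil_Integration.integral_combine[symmetric] integrable_continuous_interval cont) auto
    have "Y u \<xi> = Y 0 \<xi> - a * integral {0..u} (\<lambda>s. Y s \<xi>) + of_real \<sigma> * ?w u"
      and "Y s \<xi> = Y 0 \<xi> - a * integral {0..s} (\<lambda>s. Y s \<xi>) + of_real \<sigma> * ?w s"
      by (rule elim(1)[rule_format]; use u st in simp)+
    from arg_cong2[OF this, of "(-)"]
    have "Y u \<xi> - Y s \<xi> = (Y 0 \<xi> - a * integral {0..u} (\<lambda>s. Y s \<xi>) + of_real \<sigma> * ?w u)
        - (Y 0 \<xi> - a * integral {0..s} (\<lambda>s. Y s \<xi>) + of_real \<sigma> * ?w s)" .
    also have "\<dots> = of_real \<sigma> * dW s u \<xi> - a * integral {s..u} (\<lambda>s. Y s \<xi>)"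
      unfolding I dW_def by (simp add: algebra_simps)
    finally show ?thesis by (simp add: diff_eq_eq)
  qed
  from linear_ode_solution[OF less_imp_le[OF st(2)] cont[OF st(1)] this]
  have "Y t \<xi> = decay (t - s) * Y s \<xi> + of_real \<sigma> * dW s t \<xi>
      - a * integral {s..t} (\<lambda>u. of_real \<sigma> * (decay (t - u) * dW s u \<xi>))"
    by (simp only: mult.left_commute)
  moreover have "continuous_on {s..t} (\<lambda>u. decay (t - u) * dW s u \<xi>)"
    by (intro continuous_intros dW_continuous elim st)
  from integral_restrict_lborel(2)[OF this]
  have "integral {s..t} (\<lambda>u. decay (t - u) * dW s u \<xi>) = R s t \<xi>" by (simp add: R_def)
  ultimately show ?case by (simp add: innovation_def algebra_simps)
qed

lemma innovation_square_integrable: "0 \<le> s \<Longrightarrow> s < t \<Longrightarrow> square_integrable M (innovation s t)"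
  unfolding innovation_def
  by (intro square_integrable_cmult square_integrable_diff dW_moments memory_integral) auto

lemma innovation_orthogonal:
  assumes st: "0 \<le> s" "s < t" and X: "X \<in> borel_measurable (F s)" "square_integrable M X"
  shows "expectation (\<lambda>\<xi>. X \<xi> * innovation s t \<xi>) = 0"
proof -
  note i = square_integrable_mult[OF X(2) dW_moments(1)[OF st(1) less_imp_le[OF st(2)]]]
    square_integrable_mult[OF X(2) memory_integral(1)[OF st]]
  have "expectation (\<lambda>\<xi>. X \<xi> * innovation s t \<xi>)
      = expectation (\<lambda>\<xi>. of_real \<sigma> * (X \<xi> * dW s t \<xi>) - of_real \<sigma> * a * (X \<xi> * R s t \<xi>))"
    by (simp add: innovation_def algebra_simps)
  also have "\<dots> = of_real \<sigma> * expectation (\<lambda>\<xi>. X \<xi> * dW s t \<xi>) - of_real \<sigma> * a * expectation (\<lambda>\<xi>. X \<xi> * R s t \<xi>)"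
    using i by simp
  also have "\<dots> = 0"
    using dW_orthogonal[OF st(1) _ X(1) square_integrable_integrable[OF X(2)], of t] memory_integral(3)[OF st X] st by simp
  finally show ?thesis .
qed

lemma Y_law:
  assumes "t \<ge> 0"
  shows "distr M borel (Y t) = distr M borel (Y 0)"
proof -
  let ?P = "PiM {0..} (\<lambda>_. borel) :: (real \<Rightarrow> complex) measure"
  have m: "(\<lambda>\<xi>. \<lambda>u\<in>{0..}. Y (u + h) \<xi>) \<in> M \<rightarrow>\<^sub>M ?P" if "h \<ge> 0" for h
    using that by (intro measurable_restrict Y_measurable) auto
  have e: "(\<lambda>w. w 0) \<in> ?P \<rightarrow>\<^sub>M borel" by (rule measurable_component_singleton) simp
  have "distr M ?P (\<lambda>\<xi>. \<lambda>u\<in>{0..}. Y (u + t) \<xi>) = distr M ?P (\<lambda>\<xi>. \<lambda>u\<in>{0..}. Y u \<xi>)"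
    using OU assms by (simp add: stationary_complex_OU_def stationary_process_def)
  then have "distr (distr M ?P (\<lambda>\<xi>. \<lambda>u\<in>{0..}. Y (u + t) \<xi>)) borel (\<lambda>w. w 0)
      = distr (distr M ?P (\<lambda>\<xi>. \<lambda>u\<in>{0..}. Y u \<xi>)) borel (\<lambda>w. w 0)" by simp
  then show ?thesis
    using distr_distr[OF e m[OF assms]] distr_distr[OF e m[of 0]] by (simp add: comp_def)
qed

lemma Y_expectation_stationary:
  fixes h :: "complex \<Rightarrow> complex"
  assumes "t \<ge> 0" "h \<in> borel_measurable borel"
  shows "expectation (\<lambda>\<xi>. h (Y t \<xi>)) = expectation (\<lambda>\<xi>. h (Y 0 \<xi>))"
proof -
  have "expectation (\<lambda>\<xi>. h (Y t \<xi>)) = (LINT z|distr M borel (Y t). h z)"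
    using assms Y_measurable by (subst integral_distr) auto
  also have "\<dots> = expectation (\<lambda>\<xi>. h (Y 0 \<xi>))"
    unfolding Y_law[OF assms(1)] using assms Y_measurable by (subst integral_distr) auto
  finally show ?thesis .
qed

text \<open>A unit time step contracts the squared modulus, up to an integrable innovation term,
  while stationarity preserves its law; this is the setting of
  \<open>integrable_if_contractive\<close>.\<close>

lemma Y_square_integrable:
  assumes "t \<ge> 0"
  shows "square_integrable M (Y t)"
proof -
  \<comment> \<open>This choice makes \<open>(1 + \<epsilon>) * (cmod (decay 1))\<^sup>2\<close>
    equal to \<open>exp (- lam)\<close>, a factor below 1.\<close>
  define \<epsilon> where "\<epsilon> = exp lam - 1"
  have \<epsilon>: "\<epsilon> > 0" using lam_pos by (simp add: \<epsilon>_def)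
  have [measurable]: "Y 0 \<in> borel_measurable M" "Y 1 \<in> borel_measurable M" "Y t \<in> borel_measurable M"
    using Y_measurable assms by auto
  have sq_meas: "(\<lambda>z::complex. (cmod z)\<^sup>2) \<in> borel_measurable borel" by measurable
  have law: "distr M borel (\<lambda>\<xi>. (cmod (Y u \<xi>))\<^sup>2) = distr M borel (\<lambda>\<xi>. (cmod (Y 0 \<xi>))\<^sup>2)" if "u \<ge> 0" for u
    using distr_distr[OF sq_meas Y_measurable[OF that]] distr_distr[OF sq_meas Y_measurable[of 0]]
    unfolding Y_law[OF that] by (simp add: comp_def)
  have "integrable M (\<lambda>\<xi>. (cmod (Y 0 \<xi>))\<^sup>2)"
  proof (rule integrable_if_contractive)
    show "distr M borel (\<lambda>\<xi>. (cmod (Y 1 \<xi>))\<^sup>2) = distr M borel (\<lambda>\<xi>. (cmod (Y 0 \<xi>))\<^sup>2)"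
      by (rule law) simp
    show "integrable M (\<lambda>\<xi>. (1 + 1 / \<epsilon>) * (cmod (innovation 0 1 \<xi>))\<^sup>2)"
      using innovation_square_integrable[of 0 1] by (simp add: square_integrable_def)
    show "AE \<xi> in M. (cmod (Y 1 \<xi>))\<^sup>2 \<le> exp (- lam) * (cmod (Y 0 \<xi>))\<^sup>2 + (1 + 1 / \<epsilon>) * (cmod (innovation 0 1 \<xi>))\<^sup>2"
      using Y_solution[of 0 1, simplified]
    proof eventually_elim
      case (elim \<xi>)
      have "(1 + \<epsilon>) * (cmod (decay 1 * Y 0 \<xi>))\<^sup>2 = exp lam * (exp (- lam))\<^sup>2 * (cmod (Y 0 \<xi>))\<^sup>2"
        using cmod_decay[of 1] by (simp add: \<epsilon>_def norm_mult power_mult_distrib)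
      also have "exp lam * (exp (- lam))\<^sup>2 = exp (- lam)"
        by (simp add: power2_eq_square flip: exp_add)
      finally show ?case
        using norm_add_square_le_weighted[OF \<epsilon>, of "decay 1 * Y 0 \<xi>" "innovation 0 1 \<xi>"] elim by simp
    qed
  qed (use \<epsilon> lam_pos in auto)
  then have "integrable (distr M borel (\<lambda>\<xi>. (cmod (Y t \<xi>))\<^sup>2)) (\<lambda>x. x)"
    unfolding law[OF assms] by (subst integrable_distr_eq) auto
  then have "integrable M (\<lambda>\<xi>. (cmod (Y t \<xi>))\<^sup>2)"
    by (subst (asm) integrable_distr_eq) auto
  then show ?thesis by (simp add: square_integrable_def)
qed

text \<open>A unit time step gives a fixed-point equation for the constant mean with factor
  \<open>decay 1\<close>, which differs from 1 because its modulus is below 1.\<close>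

lemma Y_mean:
  assumes "t \<ge> 0"
  shows "expectation (Y t) = 0"
proof -
  have eq: "expectation (Y u) = expectation (Y 0)" if "u \<ge> 0" for u
    by (rule Y_expectation_stationary[OF that, of "\<lambda>z. z"]) simp
  have "expectation (Y 0) = expectation (Y 1)" using eq[of 1] by simp
  also have "\<dots> = expectation (\<lambda>\<xi>. decay 1 * Y 0 \<xi> + innovation 0 1 \<xi>)"
    using Y_solution[of 0 1] Y_measurable innovation_square_integrable[of 0 1]
    by (intro integral_cong_AE) (auto simp: square_integrable_def)
  also have "\<dots> = decay 1 * expectation (Y 0) + expectation (innovation 0 1)"
    using Y_square_integrable[of 0] innovation_square_integrable[of 0 1]
    by (simp add: square_integrable_integrable)
  also have "expectation (innovation 0 1) = 0"
    using innovation_orthogonal[of 0 1 "\<lambda>_. 1"] by (simp add: square_integrable_const)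
  finally have "(1 - decay 1) * expectation (Y 0) = 0" by (simp add: algebra_simps)
  moreover have "decay 1 \<noteq> 1" using cmod_decay[of 1] lam_pos by (auto dest: arg_cong[of _ _ cmod])
  ultimately show ?thesis using eq[OF assms] by simp
qed

text \<open>The innovation is orthogonal to every square-integrable variable known at time
  \<open>s\<close>, in particular to \<open>Y s\<close> and its conjugate.\<close>

lemma Y_cross_moments:
  assumes st: "0 \<le> s" "s < t"
  shows "expectation (\<lambda>\<xi>. Y t \<xi> * Y s \<xi>) = decay (t - s) * expectation (\<lambda>\<xi>. Y s \<xi> * Y s \<xi>)"
    and "expectation (\<lambda>\<xi>. Y t \<xi> * cnj (Y s \<xi>)) = decay (t - s) * expectation (\<lambda>\<xi>. Y s \<xi> * cnj (Y s \<xi>))"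
proof -
  have *: "expectation (\<lambda>\<xi>. Y t \<xi> * X \<xi>) = decay (t - s) * expectation (\<lambda>\<xi>. Y s \<xi> * X \<xi>)"
    if X: "X \<in> borel_measurable (F s)" "square_integrable M X" for X
  proof -
    have "expectation (\<lambda>\<xi>. Y t \<xi> * X \<xi>) = expectation (\<lambda>\<xi>. decay (t - s) * (Y s \<xi> * X \<xi>) + X \<xi> * innovation s t \<xi>)"
      using Y_solution[OF st] Y_measurable[of t] Y_measurable[of s] innovation_square_integrable[OF st] X st
      by (intro integral_cong_AE) (auto simp: square_integrable_def algebra_simps)
    also have "\<dots> = decay (t - s) * expectation (\<lambda>\<xi>. Y s \<xi> * X \<xi>) + expectation (\<lambda>\<xi>. X \<xi> * innovation s t \<xi>)"
      using square_integrable_mult[OF Y_square_integrable[OF st(1)] X(2)]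
        square_integrable_mult[OF X(2) innovation_square_integrable[OF st]] by simp
    finally show ?thesis using innovation_orthogonal[OF st X] by simp
  qed
  show "expectation (\<lambda>\<xi>. Y t \<xi> * Y s \<xi>) = decay (t - s) * expectation (\<lambda>\<xi>. Y s \<xi> * Y s \<xi>)"
    by (rule *[OF Y_adapted[OF st(1)] Y_square_integrable[OF st(1)]])
  show "expectation (\<lambda>\<xi>. Y t \<xi> * cnj (Y s \<xi>)) = decay (t - s) * expectation (\<lambda>\<xi>. Y s \<xi> * cnj (Y s \<xi>))"
    using Y_adapted[OF st(1)]
    by (intro * square_integrable_cnj Y_square_integrable st)
      (auto intro: borel_measurable_continuous_on[OF continuous_on_cnj[OF continuous_on_id]])
qed

text \<open>Balance equations: the second moments of the autoregressive form, whose cross terms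
  vanish, are equated by stationarity with those at time 0. They tie the unknown moments to the
  innovation for every positive \<open>t\<close>.\<close>

lemma Y_innovation_moments:
  assumes t: "0 < t"
  shows "expectation (\<lambda>\<xi>. Y 0 \<xi> * Y 0 \<xi>) * (1 - decay t * decay t)
      = expectation (\<lambda>\<xi>. innovation 0 t \<xi> * innovation 0 t \<xi>)"
    and "expectation (\<lambda>\<xi>. Y 0 \<xi> * cnj (Y 0 \<xi>)) * (1 - decay t * cnj (decay t))
      = expectation (\<lambda>\<xi>. innovation 0 t \<xi> * cnj (innovation 0 t \<xi>))"
proof -
  note Y0 = Y_square_integrable[of 0, OF order_refl] and N = innovation_square_integrable[OF order_refl t]
  note Y0c = square_integrable_cnj[OF Y0] and Nc = square_integrable_cnj[OF N]
  have meas [measurable]: "Y 0 \<in> borel_measurable M" "Y t \<in> borel_measurable M" "innovation 0 t \<in> borel_measurable M"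
    "(\<lambda>\<xi>. cnj (Y 0 \<xi>)) \<in> borel_measurable M" "(\<lambda>\<xi>. cnj (innovation 0 t \<xi>)) \<in> borel_measurable M"
    "(\<lambda>\<xi>. cnj (Y t \<xi>)) \<in> borel_measurable M"
    using Y0 Y0c N Nc Y_square_integrable[of t] square_integrable_cnj[OF Y_square_integrable[of t]] t
    by (auto simp: square_integrable_def)
  have cnj_meas: "cnj \<in> borel_measurable borel"
    by (intro borel_measurable_continuous_onI continuous_intros)
  note i = square_integrable_mult[OF Y0 Y0] square_integrable_mult[OF Y0 N] square_integrable_mult[OF N N]
    square_integrable_mult[OF Y0 Y0c] square_integrable_mult[OF Y0c N] square_integrable_mult[OF Y0 Nc] square_integrable_mult[OF N Nc]
  have o1: "expectation (\<lambda>\<xi>. Y 0 \<xi> * innovation 0 t \<xi>) = 0"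
    by (rule innovation_orthogonal[OF order_refl t Y_adapted[OF order_refl] Y0])
  have o2: "expectation (\<lambda>\<xi>. cnj (Y 0 \<xi>) * innovation 0 t \<xi>) = 0"
    by (rule innovation_orthogonal[OF order_refl t _ Y0c])
      (rule measurable_compose[OF Y_adapted[OF order_refl] cnj_meas])
  have o3: "expectation (\<lambda>\<xi>. Y 0 \<xi> * cnj (innovation 0 t \<xi>)) = 0"
  proof -
    have "expectation (\<lambda>\<xi>. Y 0 \<xi> * cnj (innovation 0 t \<xi>)) = expectation (\<lambda>\<xi>. cnj (cnj (Y 0 \<xi>) * innovation 0 t \<xi>))"
      by simp
    also have "\<dots> = cnj (expectation (\<lambda>\<xi>. cnj (Y 0 \<xi>) * innovation 0 t \<xi>))"
      by (rule Bochner_Integration.integral_cnj)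
    finally show ?thesis using o2 by simp
  qed
  have sol: "AE \<xi> in M. Y t \<xi> = decay t * Y 0 \<xi> + innovation 0 t \<xi>" using Y_solution[of 0 t] t by simp
  have "expectation (\<lambda>\<xi>. Y 0 \<xi> * Y 0 \<xi>) = expectation (\<lambda>\<xi>. Y t \<xi> * Y t \<xi>)"
    using Y_expectation_stationary[of t "\<lambda>z. z * z"] t by simp
  also have "\<dots> = expectation (\<lambda>\<xi>. decay t * decay t * (Y 0 \<xi> * Y 0 \<xi>)
      + 2 * decay t * (Y 0 \<xi> * innovation 0 t \<xi>) + innovation 0 t \<xi> * innovation 0 t \<xi>)"
    by (rule integral_cong_AE, measurable) (use sol in \<open>auto simp: algebra_simps\<close>)
  also have "\<dots> = decay t * decay t * expectation (\<lambda>\<xi>. Y 0 \<xi> * Y 0 \<xi>)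
      + 2 * decay t * expectation (\<lambda>\<xi>. Y 0 \<xi> * innovation 0 t \<xi>) + expectation (\<lambda>\<xi>. innovation 0 t \<xi> * innovation 0 t \<xi>)"
    using i(1-3) by simp
  finally show "expectation (\<lambda>\<xi>. Y 0 \<xi> * Y 0 \<xi>) * (1 - decay t * decay t)
      = expectation (\<lambda>\<xi>. innovation 0 t \<xi> * innovation 0 t \<xi>)"
    unfolding o1 by (simp add: algebra_simps)
  have "expectation (\<lambda>\<xi>. Y 0 \<xi> * cnj (Y 0 \<xi>)) = expectation (\<lambda>\<xi>. Y t \<xi> * cnj (Y t \<xi>))"
    using Y_expectation_stationary[of t "\<lambda>z. z * cnj z"] t cnj_meas by simp
  also have "\<dots> = expectation (\<lambda>\<xi>. decay t * cnj (decay t) * (Y 0 \<xi> * cnj (Y 0 \<xi>))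
      + decay t * (Y 0 \<xi> * cnj (innovation 0 t \<xi>)) + cnj (decay t) * (cnj (Y 0 \<xi>) * innovation 0 t \<xi>)
      + innovation 0 t \<xi> * cnj (innovation 0 t \<xi>))"
    by (rule integral_cong_AE, measurable) (use sol in \<open>auto simp: algebra_simps\<close>)
  also have "\<dots> = decay t * cnj (decay t) * expectation (\<lambda>\<xi>. Y 0 \<xi> * cnj (Y 0 \<xi>))
      + decay t * expectation (\<lambda>\<xi>. Y 0 \<xi> * cnj (innovation 0 t \<xi>)) + cnj (decay t) * expectation (\<lambda>\<xi>. cnj (Y 0 \<xi>) * innovation 0 t \<xi>)
      + expectation (\<lambda>\<xi>. innovation 0 t \<xi> * cnj (innovation 0 t \<xi>))"
    using i(4-7) by simp
  finally show "expectation (\<lambda>\<xi>. Y 0 \<xi> * cnj (Y 0 \<xi>)) * (1 - decay t * cnj (decay t))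
      = expectation (\<lambda>\<xi>. innovation 0 t \<xi> * cnj (innovation 0 t \<xi>))"
    unfolding o2 o3 by (simp add: algebra_simps)
qed

text \<open>To first order the innovation is \<open>\<sigma>\<close> times the Brownian increment D,
  with E D^2 = 0 and E |D|^2 = 2t, while every term containing \<open>R\<close> is of order t^2. In
  \<open>K\<close>, the mixed terms account for \<open>4 * cmod a\<close> and the pure one for
  \<open>2 * (cmod a)\<^sup>2\<close>.\<close>

lemma innovation_short_time:
  assumes t: "0 < t" "t \<le> 1"
  defines "K \<equiv> \<sigma>\<^sup>2 * (4 * cmod a + 2 * (cmod a)\<^sup>2)"
  shows "cmod (expectation (\<lambda>\<xi>. innovation 0 t \<xi> * innovation 0 t \<xi>)) \<le> K * t\<^sup>2"
    and "cmod (expectation (\<lambda>\<xi>. innovation 0 t \<xi> * cnj (innovation 0 t \<xi>)) - of_real t * of_real (2 * \<sigma>\<^sup>2)) \<le> K * t\<^sup>2"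
proof -
  let ?D = "dW 0 t" and ?R = "R 0 t"
  have D: "square_integrable M ?D" "expectation (\<lambda>\<xi>. (cmod (?D \<xi>))\<^sup>2) = 2 * t"
      "expectation (\<lambda>\<xi>. ?D \<xi> * ?D \<xi>) = 0"
    using dW_moments[of 0 t] t by auto
  have R: "square_integrable M ?R" "expectation (\<lambda>\<xi>. (cmod (?R \<xi>))\<^sup>2) \<le> 2 * t ^ 3"
    using memory_integral(1,2)[of 0 t] t by auto
  note Dc = square_integrable_cnj[OF D(1)] and Rc = square_integrable_cnj[OF R(1)]
  note i = square_integrable_mult[OF D(1) D(1)] square_integrable_mult[OF D(1) R(1)] square_integrable_mult[OF R(1) R(1)]
    square_integrable_mult[OF D(1) Dc] square_integrable_mult[OF D(1) Rc] square_integrable_mult[OF R(1) Dc]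
    square_integrable_mult[OF R(1) Rc]
  have "2 * t ^ 3 \<le> 2 * t\<^sup>2" using t by (simp add: power_decreasing)
  then have RR: "expectation (\<lambda>\<xi>. (cmod (?R \<xi>))\<^sup>2) \<le> 2 * t\<^sup>2" using R(2) by linarith
  have DR: "expectation (\<lambda>\<xi>. cmod (?D \<xi> * ?R \<xi>)) \<le> 2 * t\<^sup>2"
  proof -
    \<comment> \<open>The weight \<open>t\<close> balances E |D|^2 = 2t against E |R|^2 \<le> 2t^3,
      so both contributions are of order t^2.\<close>
    have "expectation (\<lambda>\<xi>. cmod (?D \<xi> * ?R \<xi>))
        \<le> expectation (\<lambda>\<xi>. (t * (cmod (?D \<xi>))\<^sup>2 + (cmod (?R \<xi>))\<^sup>2 / t) / 2)"
      using i(2) D(1) R(1) norm_mult_le_weighted[OF t(1)]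
      by (intro integral_mono integrable_norm) (auto simp: square_integrable_def)
    also have "\<dots> = (t * (2 * t) + expectation (\<lambda>\<xi>. (cmod (?R \<xi>))\<^sup>2) / t) / 2"
      using D(1,2) R(1) by (simp add: square_integrable_def)
    also have "\<dots> \<le> (t * (2 * t) + 2 * t ^ 3 / t) / 2"
      using R(2) t by (intro divide_right_mono add_left_mono) auto
    also have "\<dots> = 2 * t\<^sup>2" using t by (simp add: power2_eq_square power3_eq_cube)
    finally show ?thesis .
  qed
  have RD': "cmod (expectation (\<lambda>\<xi>. ?D \<xi> * ?R \<xi>)) \<le> 2 * t\<^sup>2"
    "cmod (expectation (\<lambda>\<xi>. ?D \<xi> * cnj (?R \<xi>))) \<le> 2 * t\<^sup>2"
    "cmod (expectation (\<lambda>\<xi>. ?R \<xi> * cnj (?D \<xi>))) \<le> 2 * t\<^sup>2"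
    using integral_norm_bound[of M "\<lambda>\<xi>. ?D \<xi> * ?R \<xi>"] integral_norm_bound[of M "\<lambda>\<xi>. ?D \<xi> * cnj (?R \<xi>)"]
      integral_norm_bound[of M "\<lambda>\<xi>. ?R \<xi> * cnj (?D \<xi>)"] DR
    by (simp_all add: norm_mult mult.commute)
  have RR': "cmod (expectation (\<lambda>\<xi>. ?R \<xi> * ?R \<xi>)) \<le> 2 * t\<^sup>2"
    "cmod (expectation (\<lambda>\<xi>. ?R \<xi> * cnj (?R \<xi>))) \<le> 2 * t\<^sup>2"
    using integral_norm_bound[of M "\<lambda>\<xi>. ?R \<xi> * ?R \<xi>"] integral_norm_bound[of M "\<lambda>\<xi>. ?R \<xi> * cnj (?R \<xi>)"] RR
    by (simp_all add: norm_mult power2_eq_square)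
  have "expectation (\<lambda>\<xi>. innovation 0 t \<xi> * innovation 0 t \<xi>) = expectation (\<lambda>\<xi>. of_real (\<sigma>\<^sup>2) *
      (?D \<xi> * ?D \<xi> - 2 * a * (?D \<xi> * ?R \<xi>) + a * a * (?R \<xi> * ?R \<xi>)))"
    by (simp add: innovation_def algebra_simps power2_eq_square)
  also have "\<dots> = of_real (\<sigma>\<^sup>2) * (expectation (\<lambda>\<xi>. ?D \<xi> * ?D \<xi>) - 2 * a * expectation (\<lambda>\<xi>. ?D \<xi> * ?R \<xi>)
      + a * a * expectation (\<lambda>\<xi>. ?R \<xi> * ?R \<xi>))"
    using i(1-3) by simp
  finally have "cmod (expectation (\<lambda>\<xi>. innovation 0 t \<xi> * innovation 0 t \<xi>))
      = \<sigma>\<^sup>2 * cmod (a * a * expectation (\<lambda>\<xi>. ?R \<xi> * ?R \<xi>) - 2 * a * expectation (\<lambda>\<xi>. ?D \<xi> * ?R \<xi>))"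
    unfolding D(3) by (simp only: norm_mult norm_of_real abs_power2) simp
  also have "\<dots> \<le> \<sigma>\<^sup>2 * (cmod a * cmod a * (2 * t\<^sup>2) + 2 * cmod a * (2 * t\<^sup>2))"
    using RR'(1) RD'(1) mult_left_mono[OF RD'(1) norm_ge_zero[of a]]
    by (intro mult_left_mono norm_triangle_le_diff add_mono) (auto simp: norm_mult intro!: mult_left_mono)
  also have "\<dots> = K * t\<^sup>2" by (simp add: K_def algebra_simps power2_eq_square)
  finally show "cmod (expectation (\<lambda>\<xi>. innovation 0 t \<xi> * innovation 0 t \<xi>)) \<le> K * t\<^sup>2" .
  have DD: "expectation (\<lambda>\<xi>. ?D \<xi> * cnj (?D \<xi>)) = of_real (2 * t)"
    using integral_complex_of_real[of M "\<lambda>\<xi>. (cmod (?D \<xi>))\<^sup>2"] unfolding complex_norm_square D(2) by simp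
  have "expectation (\<lambda>\<xi>. innovation 0 t \<xi> * cnj (innovation 0 t \<xi>)) = expectation (\<lambda>\<xi>. of_real (\<sigma>\<^sup>2) *
      (?D \<xi> * cnj (?D \<xi>) - a * (?R \<xi> * cnj (?D \<xi>)) - cnj a * (?D \<xi> * cnj (?R \<xi>)) + a * cnj a * (?R \<xi> * cnj (?R \<xi>))))"
    by (simp add: innovation_def algebra_simps power2_eq_square)
  also have "\<dots> = of_real (\<sigma>\<^sup>2) * (expectation (\<lambda>\<xi>. ?D \<xi> * cnj (?D \<xi>)) - a * expectation (\<lambda>\<xi>. ?R \<xi> * cnj (?D \<xi>))
      - cnj a * expectation (\<lambda>\<xi>. ?D \<xi> * cnj (?R \<xi>)) + a * cnj a * expectation (\<lambda>\<xi>. ?R \<xi> * cnj (?R \<xi>)))"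
    using i(4-7) by simp
  finally have "expectation (\<lambda>\<xi>. innovation 0 t \<xi> * cnj (innovation 0 t \<xi>)) - of_real t * of_real (2 * \<sigma>\<^sup>2)
      = of_real (\<sigma>\<^sup>2) * (a * cnj a * expectation (\<lambda>\<xi>. ?R \<xi> * cnj (?R \<xi>))
        - (a * expectation (\<lambda>\<xi>. ?R \<xi> * cnj (?D \<xi>)) + cnj a * expectation (\<lambda>\<xi>. ?D \<xi> * cnj (?R \<xi>))))"
    unfolding DD by (simp add: algebra_simps)
  then have "cmod (expectation (\<lambda>\<xi>. innovation 0 t \<xi> * cnj (innovation 0 t \<xi>)) - of_real t * of_real (2 * \<sigma>\<^sup>2))
      = \<sigma>\<^sup>2 * cmod (a * cnj a * expectation (\<lambda>\<xi>. ?R \<xi> * cnj (?R \<xi>))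
        - (a * expectation (\<lambda>\<xi>. ?R \<xi> * cnj (?D \<xi>)) + cnj a * expectation (\<lambda>\<xi>. ?D \<xi> * cnj (?R \<xi>))))"
    by (simp only: norm_mult norm_of_real abs_power2)
  also have "\<dots> \<le> \<sigma>\<^sup>2 * (cmod a * cmod a * (2 * t\<^sup>2) + (cmod a * (2 * t\<^sup>2) + cmod a * (2 * t\<^sup>2)))"
    using RR'(2) RD'(2,3)
    by (intro mult_left_mono norm_triangle_le_diff norm_triangle_le add_mono) (auto simp: norm_mult intro!: mult_left_mono)
  also have "\<dots> = K * t\<^sup>2" by (simp add: K_def algebra_simps power2_eq_square)
  finally show "cmod (expectation (\<lambda>\<xi>. innovation 0 t \<xi> * cnj (innovation 0 t \<xi>)) - of_real t * of_real (2 * \<sigma>\<^sup>2)) \<le> K * t\<^sup>2" .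
qed

text \<open>First-order coefficients at time 0 are compared in the balance equations, where errors
  of order t^2 are invisible: \<open>p * (2 * a)\<close> is 0, and \<open>q * (a + cnj a)\<close> is
  twice the squared \<open>\<sigma>\<close>, with \<open>a + cnj a\<close> equal to
  \<open>2 * lam\<close>.\<close>

lemma Y_second_moments:
  assumes t: "t \<ge> 0"
  shows "expectation (\<lambda>\<xi>. Y t \<xi> * Y t \<xi>) = 0"
    and "expectation (\<lambda>\<xi>. Y t \<xi> * cnj (Y t \<xi>)) = of_real (\<sigma>\<^sup>2 / lam)"
proof -
  define p where "p = expectation (\<lambda>\<xi>. Y 0 \<xi> * Y 0 \<xi>)"
  define q where "q = expectation (\<lambda>\<xi>. Y 0 \<xi> * cnj (Y 0 \<xi>))"
  have a_nz: "a \<noteq> 0" using lam_pos by (auto simp: a_def complex_eq_iff)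
  have "((\<lambda>z. p * (1 - exp (- (a * z)) * exp (- (a * z)))) has_field_derivative p * (2 * a)) (at (of_real 0))"
    by (auto intro!: derivative_eq_intros)
  from has_vector_derivative_real_field[OF this]
  have "((\<lambda>h. p * (1 - decay h * decay h)) has_vector_derivative p * (2 * a)) (at 0)" .
  then have "p * (2 * a) = 0"
    by (rule derivative_eq_if_quadratic_error[where K="\<sigma>\<^sup>2 * (4 * cmod a + 2 * (cmod a)\<^sup>2)"])
      (simp_all only: p_def Y_innovation_moments mult_zero_right diff_zero innovation_short_time(1), simp_all)
  then have p: "p = 0" using a_nz by simp
  \<comment> \<open>Conjugation is not holomorphic, so \<open>cnj (decay h)\<close> is written
    through \<open>exp (- (cnj a * z))\<close>, with which it agrees at real arguments.\<close>
  have "((\<lambda>z. q * (1 - exp (- (a * z)) * exp (- (cnj a * z)))) has_field_derivative q * (a + cnj a)) (at (of_real 0))"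
    by (auto intro!: derivative_eq_intros)
  from has_vector_derivative_real_field[OF this]
  have "((\<lambda>h. q * (1 - decay h * cnj (decay h))) has_vector_derivative q * (a + cnj a)) (at 0)"
    by (simp add: exp_cnj)
  then have "q * (a + cnj a) = of_real (2 * \<sigma>\<^sup>2)"
    by (rule derivative_eq_if_quadratic_error[where K="\<sigma>\<^sup>2 * (4 * cmod a + 2 * (cmod a)\<^sup>2)"])
      (simp_all only: q_def Y_innovation_moments innovation_short_time(2), simp_all)
  moreover have "a + cnj a = of_real (2 * lam)" by (simp add: a_def complex_eq_iff)
  ultimately have q: "q = of_real (\<sigma>\<^sup>2 / lam)" using lam_pos by (simp add: field_simps)
  have cnj_meas: "cnj \<in> borel_measurable borel"
    by (intro borel_measurable_continuous_onI continuous_intros)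
  show "expectation (\<lambda>\<xi>. Y t \<xi> * Y t \<xi>) = 0"
    using Y_expectation_stationary[OF t, of "\<lambda>z. z * z"] p by (simp add: p_def)
  show "expectation (\<lambda>\<xi>. Y t \<xi> * cnj (Y t \<xi>)) = of_real (\<sigma>\<^sup>2 / lam)"
    using Y_expectation_stationary[OF t, of "\<lambda>z. z * cnj z"] q cnj_meas by (simp add: q_def)
qed

end

section \<open>Covariance and Fisher information under the normalization\<close>

locale normalized_complex_OU = complex_OU +
  assumes normalized: "\<sigma>\<^sup>2 / (2 * lam) = 1"
begin

definition corr :: "real \<Rightarrow> real \<Rightarrow> complex" where
  "corr t s = (if s \<le> t then decay (t - s) else cnj (decay (s - t)))"

text \<open>Under the normalization each real component has variance 1, hence the factor 2. Times in
  reverse order follow by commuting the factors or by conjugating the expectation.\<close>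

lemma corr_moments:
  assumes st: "0 \<le> s" "0 \<le> t"
  shows "expectation (\<lambda>\<xi>. Y t \<xi> * Y s \<xi>) = 0"
    and "expectation (\<lambda>\<xi>. Y t \<xi> * cnj (Y s \<xi>)) = 2 * corr t s"
proof -
  have n: "\<sigma>\<^sup>2 / lam = 2" using normalized lam_pos by (simp add: field_simps)
  have *: "expectation (\<lambda>\<xi>. Y t \<xi> * Y s \<xi>) = 0 \<and> expectation (\<lambda>\<xi>. Y t \<xi> * cnj (Y s \<xi>)) = 2 * decay (t - s)"
    if "0 \<le> s" "s \<le> t" for s t
    using Y_cross_moments[of s t] Y_second_moments[of s] that n by (cases "s = t") (simp_all del: of_real_divide)
  show "expectation (\<lambda>\<xi>. Y t \<xi> * Y s \<xi>) = 0"
    using *[of s t] *[of t s] st by (cases "s \<le> t") (simp_all add: mult.commute)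
  show "expectation (\<lambda>\<xi>. Y t \<xi> * cnj (Y s \<xi>)) = 2 * corr t s"
  proof (cases "s \<le> t")
    case False
    have "expectation (\<lambda>\<xi>. Y t \<xi> * cnj (Y s \<xi>)) = cnj (expectation (\<lambda>\<xi>. Y s \<xi> * cnj (Y t \<xi>)))"
      unfolding Bochner_Integration.integral_cnj[symmetric] by (simp add: mult.commute)
    then show ?thesis using *[of t s] False st by (simp add: corr_def)
  qed (use * st in \<open>simp add: corr_def\<close>)
qed

text \<open>Up to sign, products of real and imaginary parts of z and w are real or imaginary parts
  of (z cnj w + z w) / 2 or (z cnj w - z w) / 2. Since E z w = 0 here, only the hermitian moment
  survives, in the block pattern of \<open>realify\<close>.\<close>

lemma covariance_components:
  assumes st: "0 \<le> s" "0 \<le> t"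
  shows "covariance M (\<lambda>\<xi>. Re (m + Y t \<xi>)) (\<lambda>\<xi>. Re (m + Y s \<xi>)) = Re (corr t s)"
    and "covariance M (\<lambda>\<xi>. Re (m + Y t \<xi>)) (\<lambda>\<xi>. Im (m + Y s \<xi>)) = - Im (corr t s)"
    and "covariance M (\<lambda>\<xi>. Im (m + Y t \<xi>)) (\<lambda>\<xi>. Re (m + Y s \<xi>)) = Im (corr t s)"
    and "covariance M (\<lambda>\<xi>. Im (m + Y t \<xi>)) (\<lambda>\<xi>. Im (m + Y s \<xi>)) = Re (corr t s)"
proof -
  have mean: "expectation (\<lambda>\<xi>. Re (m + Y u \<xi>)) = Re m" "expectation (\<lambda>\<xi>. Im (m + Y u \<xi>)) = Im m"
    if "u \<ge> 0" for u
  proof -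
    have i: "integrable M (Y u)" by (rule square_integrable_integrable[OF Y_square_integrable[OF that]])
    have "expectation (\<lambda>\<xi>. m + Y u \<xi>) = m"
      using i Y_mean[OF that] by (simp add: prob_space)
    moreover have "integrable M (\<lambda>\<xi>. m + Y u \<xi>)" using i by simp
    ultimately show "expectation (\<lambda>\<xi>. Re (m + Y u \<xi>)) = Re m" "expectation (\<lambda>\<xi>. Im (m + Y u \<xi>)) = Im m"
      by (simp_all only: integral_Re integral_Im)
  qed
  note Yt = Y_square_integrable[OF st(2)] and Ys = Y_square_integrable[OF st(1)]
  have i: "integrable M (\<lambda>\<xi>. Y t \<xi> * Y s \<xi>)" "integrable M (\<lambda>\<xi>. Y t \<xi> * cnj (Y s \<xi>))"
    using Yt Ys by (auto intro: square_integrable_mult square_integrable_cnj)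
  then have plus: "expectation (\<lambda>\<xi>. (Y t \<xi> * cnj (Y s \<xi>) + Y t \<xi> * Y s \<xi>) / 2) = corr t s"
    and minus: "expectation (\<lambda>\<xi>. (Y t \<xi> * cnj (Y s \<xi>) - Y t \<xi> * Y s \<xi>) / 2) = corr t s"
    using corr_moments[OF st] by simp_all
  have int: "integrable M (\<lambda>\<xi>. (Y t \<xi> * cnj (Y s \<xi>) + Y t \<xi> * Y s \<xi>) / 2)"
    "integrable M (\<lambda>\<xi>. (Y t \<xi> * cnj (Y s \<xi>) - Y t \<xi> * Y s \<xi>) / 2)"
    using i by simp_all
  have "covariance M (\<lambda>\<xi>. Re (m + Y t \<xi>)) (\<lambda>\<xi>. Re (m + Y s \<xi>))
      = expectation (\<lambda>\<xi>. Re ((Y t \<xi> * cnj (Y s \<xi>) + Y t \<xi> * Y s \<xi>) / 2))"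
    unfolding covariance_def mean(1)[OF st(1)] mean(1)[OF st(2)] by (simp add: mult.commute)
  then show "covariance M (\<lambda>\<xi>. Re (m + Y t \<xi>)) (\<lambda>\<xi>. Re (m + Y s \<xi>)) = Re (corr t s)"
    unfolding integral_Re[OF int(1)] plus .
  have "covariance M (\<lambda>\<xi>. Im (m + Y t \<xi>)) (\<lambda>\<xi>. Im (m + Y s \<xi>))
      = expectation (\<lambda>\<xi>. Re ((Y t \<xi> * cnj (Y s \<xi>) - Y t \<xi> * Y s \<xi>) / 2))"
    unfolding covariance_def mean(2)[OF st(1)] mean(2)[OF st(2)] by (simp add: mult.commute)
  then show "covariance M (\<lambda>\<xi>. Im (m + Y t \<xi>)) (\<lambda>\<xi>. Im (m + Y s \<xi>)) = Re (corr t s)"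
    unfolding integral_Re[OF int(2)] minus .
  have "covariance M (\<lambda>\<xi>. Im (m + Y t \<xi>)) (\<lambda>\<xi>. Re (m + Y s \<xi>))
      = expectation (\<lambda>\<xi>. Im ((Y t \<xi> * cnj (Y s \<xi>) + Y t \<xi> * Y s \<xi>) / 2))"
    unfolding covariance_def mean(1)[OF st(1)] mean(2)[OF st(2)] by (simp add: mult.commute)
  then show "covariance M (\<lambda>\<xi>. Im (m + Y t \<xi>)) (\<lambda>\<xi>. Re (m + Y s \<xi>)) = Im (corr t s)"
    unfolding integral_Im[OF int(1)] plus .
  have "covariance M (\<lambda>\<xi>. Re (m + Y t \<xi>)) (\<lambda>\<xi>. Im (m + Y s \<xi>))
      = expectation (\<lambda>\<xi>. - Im ((Y t \<xi> * cnj (Y s \<xi>) - Y t \<xi> * Y s \<xi>) / 2))"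
    unfolding covariance_def mean(2)[OF st(1)] mean(1)[OF st(2)] by (simp add: mult.commute)
  then show "covariance M (\<lambda>\<xi>. Re (m + Y t \<xi>)) (\<lambda>\<xi>. Im (m + Y s \<xi>)) = - Im (corr t s)"
    unfolding Bochner_Integration.integral_minus integral_Im[OF int(2)] minus .
qed

lemma design_gap_pos: "design n t \<Longrightarrow> j \<in> {1..<n} \<Longrightarrow> t j < t (j + 1)"
  by (auto simp: design_def strict_mono_on_def)

lemma design_mono: "design n t \<Longrightarrow> 1 \<le> i \<Longrightarrow> i \<le> j \<Longrightarrow> j \<le> n \<Longrightarrow> t i \<le> t j"
  by (cases "i = j") (auto simp: design_def strict_mono_on_def less_imp_le)

lemma design_nonneg: "design n t \<Longrightarrow> 1 \<le> j \<Longrightarrow> j \<le> n \<Longrightarrow> 0 \<le> t j"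
  using design_mono[of n t 1 j] by (auto simp: design_def)

text \<open>Gaps between ordered times add, so the exponentials multiply, which is the Markov
  factorisation; positive gaps give the contraction. \<open>Suc\<close> translates matrix indices
  from 0 into design points from 1.\<close>

lemma markov_kernel_corr:
  assumes "design n t"
  shows "markov_kernel (\<lambda>j k. corr (t (Suc j)) (t (Suc k))) n"
proof
  have less: "t (Suc j) < t (Suc (Suc j))" if "Suc j < n" for j
    using design_gap_pos[OF assms, of "Suc j"] that by simp
  show "corr (t (Suc j)) (t (Suc j)) = 1" if "j < n" for j by (simp add: corr_def)
  show "corr (t (Suc i)) (t (Suc k)) = corr (t (Suc i)) (t (Suc j)) * corr (t (Suc j)) (t (Suc k))"
    if "k \<le> j" "j \<le> i" "i < n" for i j k
  proof -
    have "t (Suc k) \<le> t (Suc j)" "t (Suc j) \<le> t (Suc i)"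
      using that by (auto intro!: design_mono[OF assms])
    then show ?thesis by (simp add: corr_def algebra_simps flip: exp_add)
  qed
  show "corr (t (Suc j)) (t (Suc i)) = cnj (corr (t (Suc i)) (t (Suc j)))" if "i < n" "j < n" for i j
    by (cases "t (Suc i)" "t (Suc j)" rule: linorder_cases) (simp_all add: corr_def)
  show "cmod (corr (t (Suc (Suc j))) (t (Suc j))) < 1" if "Suc j < n" for j
    using less[OF that] lam_pos by (simp add: corr_def a_def)
qed

lemma C_mat_eq_realify:
  assumes "design n t"
  shows "C_mat M (\<lambda>s \<xi>. m + Y s \<xi>) n t = realify (markov_kernel.K (\<lambda>j k. corr (t (Suc j)) (t (Suc k))) n)"
proof (rule eq_matI)
  interpret markov_kernel "\<lambda>j k. corr (t (Suc j)) (t (Suc k))" n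
    by (rule markov_kernel_corr[OF assms])
  show "dim_row (C_mat M (\<lambda>s \<xi>. m + Y s \<xi>) n t) = dim_row (realify K)"
    "dim_col (C_mat M (\<lambda>s \<xi>. m + Y s \<xi>) n t) = dim_col (realify K)"
    by (simp_all add: C_mat_def realify_def K_def)
  fix k l assume "k < dim_row (realify K)" "l < dim_col (realify K)"
  then have kl: "k < 2 * n" "l < 2 * n" "k div 2 < n" "l div 2 < n"
    by (auto simp: realify_def K_def)
  then have "0 \<le> t (Suc (k div 2))" "0 \<le> t (Suc (l div 2))"
    by (auto intro!: design_nonneg[OF assms])
  note c = covariance_components[OF this(2,1), of m]
  show "C_mat M (\<lambda>s \<xi>. m + Y s \<xi>) n t $$ (k, l) = realify K $$ (k, l)"
  proof -
    have obs: "observation (\<lambda>s \<xi>. m + Y s \<xi>) t k = (if even k then (\<lambda>\<xi>. Re (m + Y (t (Suc (k div 2))) \<xi>))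
        else (\<lambda>\<xi>. Im (m + Y (t (Suc (k div 2))) \<xi>)))" for k
      by (auto simp: observation_def)
    have "C_mat M (\<lambda>s \<xi>. m + Y s \<xi>) n t $$ (k, l)
        = covariance M (observation (\<lambda>s \<xi>. m + Y s \<xi>) t k) (observation (\<lambda>s \<xi>. m + Y s \<xi>) t l)"
      using kl by (simp add: C_mat_def)
    moreover have "realify K $$ (k, l) = (let z = corr (t (Suc (k div 2))) (t (Suc (l div 2))) in
        if even k then (if even l then Re z else - Im z) else (if even l then Im z else Re z))"
      using kl by (simp add: realify_def K_def)
    ultimately show ?thesis
      unfolding obs by (simp only: c Let_def split: if_split) simp
  qed
qed

text \<open>The first observation contributes 1; each later innovation contributes |1 - decay d|^2 /
  (1 - |decay d|^2), which is \<open>g lam \<omega> d\<close> for the gap d preceding it.\<close>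

lemma det_fisher_information_eq:
  assumes t: "design n t" and n: "n \<ge> 1"
  shows "Determinant.det (fisher_information M (\<lambda>s \<xi>. m + Y s \<xi>) n t)
    = (1 + (\<Sum>j\<in>{1..<n}. g lam \<omega> (t (j + 1) - t j)))\<^sup>2"
proof -
  interpret markov_kernel "\<lambda>j k. corr (t (Suc j)) (t (Suc k))" n
    by (rule markov_kernel_corr[OF t])
  let ?f = "\<lambda>j. (cmod (if j = 0 then 1 else 1 - corr (t (Suc j)) (t (Suc (j - 1)))))\<^sup>2 /
      (if j = 0 then 1 else 1 - (cmod (corr (t (Suc j)) (t (Suc (j - 1)))))\<^sup>2)"
  have "?f j = g lam \<omega> (t (j + 1) - t j)" if j: "j \<in> {1..<n}" for j
  proof -
    define d where "d = t (j + 1) - t j"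
    have d: "d > 0" using design_gap_pos[OF t j] by (simp add: d_def)
    have corr_d: "corr (t (Suc j)) (t (Suc (j - 1))) = decay d" using d j by (simp add: corr_def d_def)
    have sq: "(exp (- lam * d))\<^sup>2 = exp (- 2 * lam * d)" by (simp add: power2_eq_square flip: exp_add)
    have "(cmod (1 - decay d))\<^sup>2 = 1 - 2 * Re (decay d) + (cmod (decay d))\<^sup>2"
      by (simp only: cmod_power2) (simp add: power2_eq_square algebra_simps)
    also have "Re (decay d) = exp (- lam * d) * cos (\<omega> * d)"
      by (simp add: Re_exp a_def)
    finally have "(cmod (1 - decay d))\<^sup>2 = 1 - 2 * exp (- lam * d) * cos (\<omega> * d) + exp (- 2 * lam * d)"
      unfolding cmod_decay sq by simp
    then have "(cmod (1 - decay d))\<^sup>2 / (1 - (cmod (decay d))\<^sup>2) = g lam \<omega> d"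
      unfolding cmod_decay sq g_def using d by simp
    then show ?thesis using j unfolding corr_d by (simp add: d_def)
  qed
  then have "(\<Sum>j<n. ?f j) = 1 + (\<Sum>j\<in>{1..<n}. g lam \<omega> (t (j + 1) - t j))"
    using n by (simp add: lessThan_atLeast0 sum.atLeast_Suc_lessThan)
  then show ?thesis
    unfolding det_fisher_information[OF C_mat_eq_realify[OF t]] by simp
qed

end

section \<open>The optimal design\<close>

theorem theorem3p2:
  fixes M :: "'a measure" and F :: "real \<Rightarrow> 'a measure"
    and W1 W2 :: "real \<Rightarrow> 'a \<Rightarrow> real" and Y :: "real \<Rightarrow> 'a \<Rightarrow> complex"
    and lam \<omega> \<sigma> :: real and m :: complex and n :: nat
  assumes "lam > 0" and "\<omega> \<noteq> 0" and "n \<ge> 2"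
    and "\<sigma>\<^sup>2 / (2 * lam) = 1"
    and "stationary_complex_OU M F W1 W2 lam \<omega> \<sigma> Y"
  shows "\<exists>dstar>0.
      (\<forall>x. is_arg_max (g lam \<omega>) (\<lambda>x. 0 \<le> x) x \<longleftrightarrow> x = dstar) \<and>
      (\<forall>t. D_optimal M (\<lambda>s \<xi>. m + Y s \<xi>) n t \<longleftrightarrow>
           design n t \<and> (\<forall>j\<in>{1..<n}. t (j + 1) - t j = dstar))"
proof -
  interpret prob_space M using assms(5) by (simp add: stationary_complex_OU_def)
  interpret normalized_complex_OU M F W1 W2 lam \<omega> \<sigma> Y
    by unfold_locales (use assms in auto)
  obtain d where d: "d > 0" and max: "\<And>x. x \<ge> 0 \<Longrightarrow> x \<noteq> d \<Longrightarrow> g lam \<omega> x < g lam \<omega> d"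
    using g_unique_maximum[OF assms(1,2)] by blast
  have max_le: "g lam \<omega> x \<le> g lam \<omega> d" if "x \<ge> 0" for x
    using max[OF that] by (cases "x = d") auto
  let ?G = "\<lambda>t. \<Sum>j\<in>{1..<n}. g lam \<omega> (t (j + 1) - t j)"
  let ?top = "\<Sum>j\<in>{1..<n}. g lam \<omega> d"
  have gap: "t (j + 1) - t j > 0" if "design n t" "j \<in> {1..<n}" for t j
    using design_gap_pos[OF that] by simp
  have G_nonneg: "?G t \<ge> 0" if "design n t" for t
    using gap[OF that] by (intro sum_nonneg g_nonneg assms(1)) (simp add: less_imp_le)
  have det: "Determinant.det (fisher_information M (\<lambda>s \<xi>. m + Y s \<xi>) n t) = (1 + ?G t)\<^sup>2" if "design n t" for t
    using det_fisher_information_eq[OF that] assms(3) by simp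
  \<comment> \<open>Both determinants are squares of nonnegative numbers, so their order is that of
    the sums.\<close>
  have less_iff: "Determinant.det (fisher_information M (\<lambda>s \<xi>. m + Y s \<xi>) n t)
      < Determinant.det (fisher_information M (\<lambda>s \<xi>. m + Y s \<xi>) n u) \<longleftrightarrow> ?G t < ?G u"
    if "design n t" "design n u" for t u
    unfolding det[OF that(1)] det[OF that(2)]
    using G_nonneg[OF that(1)] G_nonneg[OF that(2)] unfolding not_le[symmetric] by (simp add: power_mono_iff)
  have G_le: "?G t \<le> ?top" if "design n t" for t
    using gap[OF that] by (intro sum_mono max_le) (simp add: less_imp_le)
  \<comment> \<open>A single gap different from \<open>d\<close> causes a strict loss because the
    maximum point of \<open>g\<close> is unique.\<close>
  have G_eq_iff: "?G t \<ge> ?top \<longleftrightarrow> (\<forall>j\<in>{1..<n}. t (j + 1) - t j = d)" if t: "design n t" for t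
  proof
    assume ge: "?G t \<ge> ?top"
    show "\<forall>j\<in>{1..<n}. t (j + 1) - t j = d"
    proof (rule ballI, rule ccontr)
      fix j assume j: "j \<in> {1..<n}" "t (j + 1) - t j \<noteq> d"
      have "?G t < ?top"
      proof (rule sum_strict_mono_ex1)
        show "\<forall>i\<in>{1..<n}. g lam \<omega> (t (i + 1) - t i) \<le> g lam \<omega> d"
          using gap[OF t] by (intro ballI max_le) (simp add: less_imp_le)
        show "\<exists>i\<in>{1..<n}. g lam \<omega> (t (i + 1) - t i) < g lam \<omega> d"
          using j gap[OF t j(1)] by (intro bexI[of _ j] max) auto
      qed simp
      then show False using ge by simp
    qed
  qed simp
  \<comment> \<open>The shift by one places the first design point at 0. This design attains the
    upper bound, so an optimal design has to reach \<open>?top\<close>.\<close>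
  have equidistant: "design n (\<lambda>j. (real j - 1) * d)" "?G (\<lambda>j. (real j - 1) * d) = ?top"
    using d by (auto simp: design_def strict_mono_on_def algebra_simps)
  have "is_arg_max (g lam \<omega>) (\<lambda>x. 0 \<le> x) x \<longleftrightarrow> x = d" for x
  proof
    assume "is_arg_max (g lam \<omega>) (\<lambda>x. 0 \<le> x) x"
    then have "x \<ge> 0" "\<not> g lam \<omega> x < g lam \<omega> d" using d by (auto simp: is_arg_max_def)
    then show "x = d" using max by blast
  qed (use d max_le in \<open>auto simp: is_arg_max_def not_less\<close>)
  moreover have "D_optimal M (\<lambda>s \<xi>. m + Y s \<xi>) n t \<longleftrightarrow> design n t \<and> (\<forall>j\<in>{1..<n}. t (j + 1) - t j = d)" for t
  proof -
    have "D_optimal M (\<lambda>s \<xi>. m + Y s \<xi>) n t \<longleftrightarrow> design n t \<and> (\<forall>u. design n u \<longrightarrow>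
        \<not> Determinant.det (fisher_information M (\<lambda>s \<xi>. m + Y s \<xi>) n t)
          < Determinant.det (fisher_information M (\<lambda>s \<xi>. m + Y s \<xi>) n u))"
      unfolding D_optimal_def is_arg_max_def by blast
    also have "\<dots> \<longleftrightarrow> design n t \<and> (\<forall>u. design n u \<longrightarrow> ?G u \<le> ?G t)"
      by (intro conj_cong refl all_cong1 imp_cong) (simp only: less_iff not_less)
    also have "\<dots> \<longleftrightarrow> design n t \<and> ?G t \<ge> ?top"
    proof (intro conj_cong refl iffI allI impI)
      assume le: "\<forall>u. design n u \<longrightarrow> ?G u \<le> ?G t"
      from le[rule_format, OF equidistant(1)] show "?top \<le> ?G t" unfolding equidistant(2) .
    next
      fix u assume top: "?top \<le> ?G t" and u: "design n u"
      show "?G u \<le> ?G t" by (rule order_trans[OF G_le[OF u] top])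
    qed
    finally show ?thesis using G_eq_iff[of t] by blast
  qed
  ultimately show ?thesis using d by blast
qed

end
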